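(* Any triangle coloring of the plane $\mathbb{R}^2$ uses at least $7$ colors.
   Context: A polygon coloring is a mapping from $\mathbb{R}^2$ to a finite set of colors such that any two points at distance one are colored differently, and the plane is partitioned into regions, borders and vertices as follows. Vertices are points; borders are open line segments whose endpoints are vertices; regions are uniformly colored open polygons enclosed by borders and vertices. Any regions sharing the same vertex or the same border are colored differently. A point is called a vertex only if there exists a pair of borders connected to it forming an angle other than $\pi$. The coloring is locally finite: any disk meets only finitely many regions, borders and vertices. Borders and vertices may be colored arbitrarily. A triangle coloring is a polygon coloring in which every region is a (open) triangle. *)

theory Defs
  imports "HOL-Analysis.Analysis" "HOL-Library.Disjoint_Sets"
begin

fun polygonal_path :: "'a::real_normed_vector list \<Rightarrow> real \<Rightarrow> 'a" where
  "polygonal_path [] = linepath 0 0"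
| "polygonal_path [a] = linepath a a"
| "polygonal_path [a, b] = linepath a b"
| "polygonal_path (a # b # c # vs) = linepath a b +++ polygonal_path (b # c # vs)"

text \<open>
  An open polygon is the region enclosed by a simple closed polygonal curve. Consecutive
  corners may be collinear, so a side may be subdivided by further vertices.
\<close>

definition open_polygon :: "(real ^ 2) set \<Rightarrow> bool" where
  "open_polygon P \<longleftrightarrow>
     (\<exists>vs. 3 \<le> length vs \<and> simple_path (polygonal_path (vs @ [hd vs])) \<and>
           P = inside (path_image (polygonal_path (vs @ [hd vs]))))"

definition open_triangle :: "(real ^ 2) set \<Rightarrow> bool" where
  "open_triangle P \<longleftrightarrow>
     (\<exists>a b c. \<not> collinear {a, b, c} \<and> P = interior (convex hull {a, b, c}))"

lemma open_triangle_imp_open_polygon: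
  assumes "open_triangle P"
  shows "open_polygon P"
proof -
  obtain a b c where nc: "\<not> collinear {a,b,c}" and P: "P = interior (convex hull {a,b,c})"
    using assms unfolding open_triangle_def by blast
  have ne: "a \<noteq> b" "b \<noteq> c" "c \<noteq> a" using nc by (auto simp: insert_commute)
  have bc: "closed_segment a b \<inter> closed_segment b c = {b}"
    by (rule Int_closed_segment) (use nc in auto)
  have ca: "closed_segment b c \<inter> closed_segment c a = {c}"
    by (rule Int_closed_segment) (use nc in \<open>auto simp: insert_commute\<close>)
  have ab: "closed_segment c a \<inter> closed_segment a b = {a}"
    by (rule Int_closed_segment) (use nc in \<open>auto simp: insert_commute\<close>)
  have arc: "arc (linepath b c +++ linepath c a)"
    using ne ca by (intro arc_join) auto
  have sp: "simple_path (linepath a b +++ (linepath b c +++ linepath c a))"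
    using ne bc ab arc by (intro simple_path_join_loop) (auto simp: path_image_join)
  have "P = inside (path_image (linepath a b +++ (linepath b c +++ linepath c a)))"
    using P inside_of_triangle[of a b c] by (simp add: path_image_join Un_assoc)
  with sp show ?thesis
    unfolding open_polygon_def by (intro exI[of _ "[a,b,c]"]) simp
qed

definition angle_at :: "real ^ 2 \<Rightarrow> real ^ 2 \<Rightarrow> real ^ 2 \<Rightarrow> real" where
  "angle_at v p q = arccos (((p - v) \<bullet> (q - v)) / (norm (p - v) * norm (q - v)))"

text \<open>
  In \<open>partition\<close> the vertices enter as singletons. The colors of borders and vertices are only
  restricted by \<open>unit_distance\<close>. A vertex may lie in the relative interior of a side of a region;
  it still counts as a vertex of that region in \<open>vertex_colors\<close>.
\<close>

locale polygon_coloring =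
  fixes col :: "real ^ 2 \<Rightarrow> 'c"
    and regions borders :: "(real ^ 2) set set"
    and vertices :: "(real ^ 2) set"
  assumes finite_colors: "finite (range col)"
    and unit_distance: "\<And>x y. dist x y = 1 \<Longrightarrow> col x \<noteq> col y"
    and partition: "partition_on UNIV (regions \<union> borders \<union> (\<lambda>v. {v}) ` vertices)"
    and border: "\<And>b. b \<in> borders \<Longrightarrow>
          \<exists>p\<in>vertices. \<exists>q\<in>vertices. p \<noteq> q \<and> b = open_segment p q"
    and region_polygon: "\<And>P. P \<in> regions \<Longrightarrow> open_polygon P"
    and region_enclosed: "\<And>P. P \<in> regions \<Longrightarrow>
          \<exists>B\<subseteq>borders. \<exists>V\<subseteq>vertices. frontier P = \<Union>B \<union> V"
    and region_uniform: "\<And>P. P \<in> regions \<Longrightarrow> col constant_on P"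
    and vertex_colors: "\<And>P Q v x y.
          \<lbrakk>P \<in> regions; Q \<in> regions; P \<noteq> Q; v \<in> vertices; v \<in> frontier P; v \<in> frontier Q;
           x \<in> P; y \<in> Q\<rbrakk> \<Longrightarrow> col x \<noteq> col y"
    and border_colors: "\<And>P Q b x y.
          \<lbrakk>P \<in> regions; Q \<in> regions; P \<noteq> Q; b \<in> borders; b \<subseteq> frontier P; b \<subseteq> frontier Q;
           x \<in> P; y \<in> Q\<rbrakk> \<Longrightarrow> col x \<noteq> col y"
    and vertex_angle: "\<And>v. v \<in> vertices \<Longrightarrow>
          \<exists>p q. p \<noteq> v \<and> q \<noteq> v \<and> p \<noteq> q \<and>
                open_segment v p \<in> borders \<and> open_segment v q \<in> borders \<and>
                angle_at v p q \<noteq> pi"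
    and locally_finite: "\<And>x r.
          finite {A \<in> regions \<union> borders \<union> (\<lambda>v. {v}) ` vertices. A \<inter> cball x r \<noteq> {}}"

locale triangle_coloring = polygon_coloring +
  assumes region_triangle: "\<And>P. P \<in> regions \<Longrightarrow> open_triangle P"

end

theory Submission
  imports Defs
begin

text \<open>
  Suppose six colors suffice. Triangles of one color have disjoint closures, and no two of their
  points are at distance one.

  If four triangles meet at \<open>v\<close>, only two colors remain for the unit circle around \<open>v\<close>. Two triangles
  alternate at some point of this circle, and since points of the circle \<open>60\<close> degrees apart are colored
  differently, they also alternate at its images \<open>w\<^sub>j\<close> under rotations by multiples of \<open>60\<close> degrees.
  The two triangles at \<open>w\<^sub>j\<close> are confined to sectors that leave a gap towards \<open>v\<close> and a gap away from \<open>v\<close>, so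
  at least four triangles meet at \<open>w\<^sub>j\<close>, and the argument applies to the unit circle around \<open>w\<^sub>j\<close> at its
  point \<open>v\<close>. The confinement there, for several \<open>j\<close>, yields five different triangles at \<open>v\<close>, which with the
  two colors of the circle is one color too many.

  If at most three triangles meet at every point, at most one of the corners at a point is acute.
  Along a side of a triangle with an acute end, acuteness at the forward end then propagates from one
  triangle across that side to the next, until one of them overhangs the acute end. Overhangs on two
  sides at the same corner are incompatible, and following these alternatives around a side with two
  acute ends gives a contradiction. This argument is local: the triangles may become arbitrarily small,
  so counting angles against vertices in large disks would not suffice.
\<close>

section \<open>Triangles in the plane\<close>

text \<open>The determinant of two plane vectors: its sign gives their orientation, and for nonzero
  vectors it vanishes exactly when they are parallel.\<close>

definition cr :: "real ^ 2 \<Rightarrow> real ^ 2 \<Rightarrow> real" where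
  "cr u v = u $ 1 * v $ 2 - u $ 2 * v $ 1"

lemma cr_linear [simp]:
  "cr (u + v) w = cr u w + cr v w" "cr w (u + v) = cr w u + cr w v"
  "cr (k *\<^sub>R u) w = k * cr u w" "cr w (k *\<^sub>R u) = k * cr w u"
  "cr (- u) w = - cr u w" "cr w (- u) = - cr w u"
  "cr u u = 0" "cr 0 u = 0" "cr u 0 = 0"
  by (auto simp: cr_def algebra_simps)

lemma cr_diff: "cr (u - v) w = cr u w - cr v w" "cr w (u - v) = cr w u - cr w v"
  by (auto simp: cr_def algebra_simps)

lemma cr_commute: "cr v u = - cr u v"
  by (simp add: cr_def)

lemma cramer:
  assumes "cr u v \<noteq> 0"
  shows "w = (cr w v / cr u v) *\<^sub>R u + (cr u w / cr u v) *\<^sub>R v"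
proof -
  have "cr w v * u $ i + cr u w * v $ i = w $ i * cr u v" for i
    using exhaust_2[of i] by (auto simp: cr_def algebra_simps)
  then show ?thesis using assms by (simp add: vec_eq_iff add_divide_distrib [symmetric])
qed

lemma cr_zero_parallel:
  assumes "cr u v = 0" "u \<noteq> 0"
  obtains k where "v = k *\<^sub>R u"
proof -
  have "u $ 1 \<noteq> 0 \<or> u $ 2 \<noteq> 0" using assms(2) by (simp add: vec_eq_iff forall_2)
  then have "v = (if u $ 1 \<noteq> 0 then v $ 1 / u $ 1 else v $ 2 / u $ 2) *\<^sub>R u"
    using assms(1) by (auto simp: cr_def vec_eq_iff forall_2 field_simps)
  then show ?thesis by (rule that)
qed

lemma collinear_iff_cr: "collinear {x, y, z} \<longleftrightarrow> cr (y - x) (z - x) = 0"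
proof
  assume "collinear {x, y, z}"
  then obtain u where u: "\<And>p q. \<lbrakk>p \<in> {x,y,z}; q \<in> {x,y,z}\<rbrakk> \<Longrightarrow> \<exists>c. p - q = c *\<^sub>R u"
    unfolding collinear_def by blast
  obtain c d where "y - x = c *\<^sub>R u" "z - x = d *\<^sub>R u" using u[of y x] u[of z x] by auto
  then show "cr (y - x) (z - x) = 0" by simp
next
  assume c: "cr (y - x) (z - x) = 0"
  show "collinear {x, y, z}"
  proof (cases "y = x")
    case False
    then obtain k where k: "z - x = k *\<^sub>R (y - x)"
      using cr_zero_parallel[OF c] by auto
    show ?thesis unfolding collinear_alt
    proof (rule exI[of _ x], rule exI[of _ "y - x"], intro ballI)
      fix p assume "p \<in> {x, y, z}"
      then consider "p = x" | "p = y" | "p = z" by blast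
      then show "\<exists>c. p = x + c *\<^sub>R (y - x)"
        using k by cases (auto intro: exI[of _ 0] exI[of _ 1] simp: algebra_simps)
    qed
  qed auto
qed

abbreviation tri :: "real ^ 2 \<Rightarrow> real ^ 2 \<Rightarrow> real ^ 2 \<Rightarrow> (real ^ 2) set" where
  "tri x y z \<equiv> interior (convex hull {x, y, z})"

lemma tri_permute: "tri y x z = tri x y z" "tri x z y = tri x y z"
  by (simp_all add: insert_commute)

lemma closure_tri:
  assumes "cr (y - x) (z - x) \<noteq> 0"
  shows "closure (tri x y z) = convex hull {x, y, z}"
proof -
  have "\<not> collinear {x, y, z}" using assms by (simp only: collinear_iff_cr) simp
  then have "tri x y z \<noteq> {}"
    by (simp add: interior_convex_hull_3_minimal) (metis add_divide_distrib add_pos_pos divide_self_if less_numeral_extra(1) zero_less_divide_iff one_add_one zero_less_two verit_comp_simplify1(1))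
  then have "closure (tri x y z) = closure (convex hull {x, y, z})"
    by (intro convex_closure_interior) auto
  also have "\<dots> = convex hull {x, y, z}"
    by (intro closure_closed compact_imp_closed compact_convex_hull) auto
  finally show ?thesis .
qed

text \<open>The coefficient \<open>g\<close> is the barycentric weight of the apex \<open>r\<close>,
  and the slice of the triangle at weight \<open>g\<close> is its base scaled by
  \<open>1 - g\<close>. The origin \<open>o'\<close> is any point on the line of the base, so that
  all triangles along one line share one coordinate.\<close>

lemma mem_frame_tri:
  assumes "a < b" "cr u (r - o') \<noteq> 0"
  shows "o' + m *\<^sub>R u + g *\<^sub>R (r - o') \<in> tri (o' + a *\<^sub>R u) (o' + b *\<^sub>R u) r \<longleftrightarrow>
      0 < g \<and> a * (1 - g) < m \<and> m < b * (1 - g)" (is ?A)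
    and "o' + m *\<^sub>R u + g *\<^sub>R (r - o') \<in> closure (tri (o' + a *\<^sub>R u) (o' + b *\<^sub>R u) r) \<longleftrightarrow>
      0 \<le> g \<and> a * (1 - g) \<le> m \<and> m \<le> b * (1 - g)" (is ?B)
proof -
  define c where "c = r - o'"
  have cuc: "cr u c \<noteq> 0" using assms by (simp add: c_def)
  let ?x = "o' + a *\<^sub>R u" and ?y = "o' + b *\<^sub>R u"
  have nc: "cr (?y - ?x) (r - ?x) \<noteq> 0"
  proof -
    have "?y - ?x = (b - a) *\<^sub>R u" "r - ?x = c - a *\<^sub>R u"
      by (simp_all add: c_def algebra_simps)
    then have "cr (?y - ?x) (r - ?x) = cr ((b - a) *\<^sub>R u) (c - a *\<^sub>R u)"
      by (simp only:)
    then have "cr (?y - ?x) (r - ?x) = (b - a) * cr u c" by (simp add: cr_diff)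
    then show ?thesis using cuc assms by simp
  qed
  have *: "\<alpha> *\<^sub>R ?x + \<beta> *\<^sub>R ?y + \<gamma> *\<^sub>R r = o' + m *\<^sub>R u + g *\<^sub>R c \<longleftrightarrow>
      \<gamma> = g \<and> \<alpha> * a + \<beta> * b = m" if "\<alpha> + \<beta> + \<gamma> = 1" for \<alpha> \<beta> \<gamma>
  proof -
    have "\<alpha> *\<^sub>R ?x + \<beta> *\<^sub>R ?y + \<gamma> *\<^sub>R r - (o' + m *\<^sub>R u + g *\<^sub>R c) =
        (\<alpha> + \<beta> + \<gamma> - 1) *\<^sub>R o' + (\<alpha> * a + \<beta> * b - m) *\<^sub>R u + (\<gamma> - g) *\<^sub>R c"
      by (simp add: c_def algebra_simps)
    then have eq: "\<alpha> *\<^sub>R ?x + \<beta> *\<^sub>R ?y + \<gamma> *\<^sub>R r - (o' + m *\<^sub>R u + g *\<^sub>R c) =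
        (\<alpha> * a + \<beta> * b - m) *\<^sub>R u + (\<gamma> - g) *\<^sub>R c" (is "?l = ?r")
      using that by simp
    show ?thesis
    proof
      assume "\<alpha> *\<^sub>R ?x + \<beta> *\<^sub>R ?y + \<gamma> *\<^sub>R r = o' + m *\<^sub>R u + g *\<^sub>R c"
      then have r0: "?r = 0" using eq by simp
      have "cr u ?r = 0" "cr ?r c = 0" using r0 by (simp_all only: cr_linear)
      then show "\<gamma> = g \<and> \<alpha> * a + \<beta> * b = m" using cuc by simp
    next
      assume "\<gamma> = g \<and> \<alpha> * a + \<beta> * b = m"
      then have "?l = 0" unfolding eq by simp
      then show "\<alpha> *\<^sub>R ?x + \<beta> *\<^sub>R ?y + \<gamma> *\<^sub>R r = o' + m *\<^sub>R u + g *\<^sub>R c" by simp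
    qed
  qed
  define \<beta> where "\<beta> = (m - a * (1 - g)) / (b - a)"
  define \<alpha> where "\<alpha> = 1 - g - \<beta>"
  have \<beta>: "\<beta> * (b - a) = m - a * (1 - g)" using assms(1) by (simp add: \<beta>_def)
  then have \<alpha>: "\<alpha> * (b - a) = b * (1 - g) - m" by (simp add: \<alpha>_def algebra_simps)
  have ab: "\<alpha> + \<beta> + g = 1" "\<alpha> * a + \<beta> * b = m"
    using \<beta> by (simp_all add: \<alpha>_def algebra_simps)
  have uniq: "x = \<alpha> \<and> y = \<beta>" if "x + y + g = 1" "x * a + y * b = m" for x y
  proof -
    have x: "x = 1 - y - g" using that(1) by simp
    have "y * (b - a) = m - a * (1 - g)" using that(2) unfolding x by (simp add: algebra_simps)
    then have "y = \<beta>" using assms(1) by (simp add: \<beta>_def field_simps)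
    with that ab show ?thesis by simp
  qed
  have sg: "0 < x \<longleftrightarrow> 0 < x * (b - a)" "0 \<le> x \<longleftrightarrow> 0 \<le> x * (b - a)" for x
    using assms(1) by (simp_all add: zero_less_mult_iff zero_le_mult_iff)
  have pos: "0 < \<alpha> \<longleftrightarrow> m < b * (1 - g)" "0 < \<beta> \<longleftrightarrow> a * (1 - g) < m"
     "0 \<le> \<alpha> \<longleftrightarrow> m \<le> b * (1 - g)" "0 \<le> \<beta> \<longleftrightarrow> a * (1 - g) \<le> m"
    using sg[of \<alpha>] sg[of \<beta>] unfolding \<alpha> \<beta> by auto
  have "\<not> collinear {?x, ?y, r}" using nc by (simp only: collinear_iff_cr) simp
  then have "o' + m *\<^sub>R u + g *\<^sub>R c \<in> tri ?x ?y r \<longleftrightarrow>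
     (\<exists>x y z. 0 < x \<and> 0 < y \<and> 0 < z \<and> x + y + z = 1 \<and>
        x *\<^sub>R ?x + y *\<^sub>R ?y + z *\<^sub>R r = o' + m *\<^sub>R u + g *\<^sub>R c)"
    by (subst interior_convex_hull_3_minimal) auto
  also have "\<dots> \<longleftrightarrow> (\<exists>x y z. 0 < x \<and> 0 < y \<and> 0 < z \<and> x + y + z = 1 \<and> z = g \<and> x * a + y * b = m)"
    by (intro ex_cong1 conj_cong refl *)
  also have "\<dots> \<longleftrightarrow> 0 < \<alpha> \<and> 0 < \<beta> \<and> 0 < g"
    using ab uniq by metis
  finally show ?A using pos by (auto simp: c_def)
  have "o' + m *\<^sub>R u + g *\<^sub>R c \<in> convex hull {?x, ?y, r} \<longleftrightarrow>
     (\<exists>x y z. 0 \<le> x \<and> 0 \<le> y \<and> 0 \<le> z \<and> x + y + z = 1 \<and>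
        x *\<^sub>R ?x + y *\<^sub>R ?y + z *\<^sub>R r = o' + m *\<^sub>R u + g *\<^sub>R c)"
    unfolding convex_hull_3 mem_Collect_eq by metis
  also have "\<dots> \<longleftrightarrow> (\<exists>x y z. 0 \<le> x \<and> 0 \<le> y \<and> 0 \<le> z \<and> x + y + z = 1 \<and> z = g \<and> x * a + y * b = m)"
    by (intro ex_cong1 conj_cong refl *)
  also have "\<dots> \<longleftrightarrow> 0 \<le> \<alpha> \<and> 0 \<le> \<beta> \<and> 0 \<le> g"
    using ab uniq by metis
  finally show ?B unfolding closure_tri[OF nc] using pos by (auto simp: c_def)
qed

section \<open>Tilings by triangles\<close>

text \<open>Sides need not match: a corner of one triangle may lie inside a side of another. This is
  why aligned and overhanging sides are distinguished throughout.\<close>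

locale triangle_tiling =
  fixes R :: "(real ^ 2) set set"
  assumes triangle: "P \<in> R \<Longrightarrow> open_triangle P"
    and disjoint: "\<lbrakk>P \<in> R; Q \<in> R; P \<inter> Q \<noteq> {}\<rbrakk> \<Longrightarrow> P = Q"
    and cover: "\<exists>P\<in>R. x \<in> closure P"
    and finite_near: "finite {P \<in> R. closure P \<inter> cball x r \<noteq> {}}"
begin

definition regions_at :: "real ^ 2 \<Rightarrow> (real ^ 2) set set" where
  "regions_at p = {P \<in> R. p \<in> closure P}"

lemma regions_at_iff: "P \<in> regions_at p \<longleftrightarrow> P \<in> R \<and> p \<in> closure P"
  by (simp add: regions_at_def)

lemma finite_regions_at: "finite (regions_at p)"
  using finite_near[of p 0] by (rule rev_finite_subset) (auto simp: regions_at_def)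

lemma region_tri:
  assumes "P \<in> R"
  obtains x y z where "P = tri x y z" "cr (y - x) (z - x) \<noteq> 0"
  using triangle[OF assms] unfolding open_triangle_def collinear_iff_cr by blast

lemma region_open: "P \<in> R \<Longrightarrow> open P"
  by (erule region_tri) simp

lemma region_convex: "P \<in> R \<Longrightarrow> convex P"
  by (erule region_tri) (simp add: convex_interior)

lemma region_nonempty: "P \<in> R \<Longrightarrow> P \<noteq> {}"
proof (erule region_tri)
  fix x y z assume "P = tri x y z" "cr (y - x) (z - x) \<noteq> 0"
  then show "P \<noteq> {}" using closure_tri[of y x z] by (metis closure_empty convex_hull_eq_empty insert_not_empty)
qed

lemma region_closure_eq:
  assumes "P \<in> R" "Q \<in> R" "x \<in> P" "x \<in> closure Q"
  shows "P = Q"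
proof (rule ccontr)
  assume "P \<noteq> Q"
  then have "P \<inter> Q = {}" using disjoint assms by blast
  then have "P \<inter> closure Q = {}" using region_open assms open_Int_closure_eq_empty by blast
  then show False using assms by blast
qed

text \<open>Finitely many closed triangles cover the points \<open>p + t *\<^sub>R w\<close> for
  small \<open>t\<close>, so one of them contains such points for arbitrarily small
  \<open>t\<close>. It contains \<open>p\<close> because it is closed, and then an initial segment
  because it is convex.\<close>

lemma region_in_direction:
  obtains G \<epsilon> where "G \<in> R" "\<epsilon> > 0" "\<And>t. \<lbrakk>0 \<le> t; t \<le> \<epsilon>\<rbrakk> \<Longrightarrow> p + t *\<^sub>R w \<in> closure G"
proof -
  let ?F = "{P \<in> R. closure P \<inter> cball p (norm w) \<noteq> {}}"
  have small: "\<forall>\<^sub>F t in at_right (0::real). t < 1"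
    by (rule eventually_at_rightI[of 0 1]) auto
  have pos: "\<forall>\<^sub>F t in at_right (0::real). 0 < t"
    by (rule eventually_at_right_less)
  have "\<forall>\<^sub>F t in at_right 0. \<exists>P\<in>?F. p + t *\<^sub>R w \<in> closure P"
    using small pos
  proof eventually_elim
    case (elim t)
    obtain P where P: "P \<in> R" "p + t *\<^sub>R w \<in> closure P" using cover by blast
    have "dist p (p + t *\<^sub>R w) \<le> norm w"
      using elim by (simp add: dist_norm mult_left_le_one_le)
    then show ?case using P by (intro bexI[of _ P]) auto
  qed
  then have "\<exists>\<^sub>F t in at_right 0. \<exists>P\<in>?F. p + t *\<^sub>R w \<in> closure P"
    by (intro eventually_frequently) auto
  then obtain G where G: "G \<in> ?F" and f: "\<exists>\<^sub>F t in at_right 0. p + t *\<^sub>R w \<in> closure G"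
    using frequently_bex_finite[OF finite_near[of p "norm w"], where P = "\<lambda>t P. p + t *\<^sub>R w \<in> closure P"]
    by blast
  have "((\<lambda>t. p + t *\<^sub>R w) \<longlongrightarrow> p + 0 *\<^sub>R w) (at_right 0)" by (intro tendsto_intros)
  then have "\<forall>\<^sub>F t in at_right 0. p + t *\<^sub>R w \<in> - closure G" if "p \<notin> closure G"
    using that by (intro topological_tendstoD) auto
  then have p: "p \<in> closure G" using f by (auto simp: frequently_def)
  obtain \<epsilon> where e: "\<epsilon> > 0" "p + \<epsilon> *\<^sub>R w \<in> closure G"
    using frequently_eventually_frequently[OF f pos] by (auto dest: frequently_ex)
  have c: "convex (closure G)" using G region_convex convex_closure by blast
  show ?thesis
  proof (rule that[OF _ e(1)])
    show "G \<in> R" using G by simp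
    fix t :: real assume t: "0 \<le> t" "t \<le> \<epsilon>"
    have "(1 - t / \<epsilon>) *\<^sub>R p + (t / \<epsilon>) *\<^sub>R (p + \<epsilon> *\<^sub>R w) \<in> closure G"
      using c p e t by (intro convexD) auto
    then show "p + t *\<^sub>R w \<in> closure G" using e(1) by (simp add: algebra_simps)
  qed
qed

section \<open>Triangles with a side on a given line\<close>

text \<open>The orientation sign \<open>s\<close> selects the side of the line on which \<open>P\<close> lies.\<close>

definition side_at :: "real \<Rightarrow> real ^ 2 \<Rightarrow> real ^ 2 \<Rightarrow> real \<Rightarrow> real \<Rightarrow> real ^ 2 \<Rightarrow> (real ^ 2) set \<Rightarrow> bool" where
  "side_at s p u a b r P \<longleftrightarrow>
     P \<in> R \<and> a < b \<and> 0 < s * cr u (r - p) \<and> P = tri (p + a *\<^sub>R u) (p + b *\<^sub>R u) r"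

lemma side_at_mem:
  assumes "side_at s p u a b r P"
  shows "p + m *\<^sub>R u + g *\<^sub>R (r - p) \<in> P \<longleftrightarrow> 0 < g \<and> a * (1 - g) < m \<and> m < b * (1 - g)"
    and "p + m *\<^sub>R u + g *\<^sub>R (r - p) \<in> closure P \<longleftrightarrow> 0 \<le> g \<and> a * (1 - g) \<le> m \<and> m \<le> b * (1 - g)"
proof -
  have "cr u (r - p) \<noteq> 0" "a < b" "P = tri (p + a *\<^sub>R u) (p + b *\<^sub>R u) r"
    using assms by (auto simp: side_at_def)
  then show "p + m *\<^sub>R u + g *\<^sub>R (r - p) \<in> P \<longleftrightarrow> 0 < g \<and> a * (1 - g) < m \<and> m < b * (1 - g)"
    "p + m *\<^sub>R u + g *\<^sub>R (r - p) \<in> closure P \<longleftrightarrow> 0 \<le> g \<and> a * (1 - g) \<le> m \<and> m \<le> b * (1 - g)"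
    using mem_frame_tri[of a b u r p m g] by simp_all
qed

lemma side_at_line:
  assumes "side_at s p u a b r P"
  shows "p + m *\<^sub>R u \<notin> P"
    and "p + m *\<^sub>R u \<in> closure P \<longleftrightarrow> a \<le> m \<and> m \<le> b"
  using side_at_mem[OF assms, of m 0] by auto

lemma side_at_reverse:
  "side_at s p u a b r P \<longleftrightarrow> side_at (- s) p (- u) (- b) (- a) r P"
  by (auto simp: side_at_def tri_permute)

lemma side_at_closure_half_plane:
  assumes "side_at s p u a b r P" "x \<in> closure P"
  shows "0 \<le> s * cr u (x - p)"
proof -
  have n: "cr u (r - p) \<noteq> 0" using assms by (auto simp: side_at_def)
  have s: "0 < s * cr u (r - p)" using assms by (auto simp: side_at_def)
  obtain m g where x: "x - p = m *\<^sub>R u + g *\<^sub>R (r - p)" using cramer[OF n] by blast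
  then have "x = p + m *\<^sub>R u + g *\<^sub>R (r - p)" by (simp add: algebra_simps)
  then have "0 \<le> g" using side_at_mem(2)[OF assms(1), of m g] assms(2) by simp
  then show ?thesis unfolding x using s by simp (metis mult.left_commute mult_nonneg_nonneg less_imp_le)
qed

lemma side_at_near:
  assumes "side_at s p u a b r P" "a < m" "m < b" "0 < s * cr u w"
  shows "\<forall>\<^sub>F t in at_right 0. p + m *\<^sub>R u + t *\<^sub>R w \<in> P"
proof -
  have n: "cr u (r - p) \<noteq> 0" and ss: "0 < s * cr u (r - p)"
    using assms by (auto simp: side_at_def)
  define k where "k = cr u w / cr u (r - p)"
  obtain h where w: "w = h *\<^sub>R u + k *\<^sub>R (r - p)" using cramer[OF n, of w] k_def by blast
  have k: "0 < k" using ss assms(4) unfolding k_def by (auto simp: zero_less_mult_iff zero_less_divide_iff)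
  have "((\<lambda>t. m + t * h - a * (1 - t * k)) \<longlongrightarrow> m + 0 * h - a * (1 - 0 * k)) (at_right 0)"
    "((\<lambda>t. b * (1 - t * k) - (m + t * h)) \<longlongrightarrow> b * (1 - 0 * k) - (m + 0 * h)) (at_right 0)"
    by (intro tendsto_intros)+
  then have "\<forall>\<^sub>F t in at_right 0. 0 < m + t * h - a * (1 - t * k)"
    "\<forall>\<^sub>F t in at_right 0. 0 < b * (1 - t * k) - (m + t * h)"
    using assms(2,3) by (auto dest!: order_tendstoD(1)[where a = 0])
  then show ?thesis using eventually_at_right_less[of 0]
  proof eventually_elim
    case (elim t)
    have "p + m *\<^sub>R u + t *\<^sub>R w = p + (m + t * h) *\<^sub>R u + (t * k) *\<^sub>R (r - p)"
      unfolding w by (simp add: algebra_simps)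
    moreover have "0 < t * k" using elim k by simp
    ultimately show ?case
      using elim by (simp only: side_at_mem(1)[OF assms(1)]) simp
  qed
qed

text \<open>Just inside a common interior point of the two bases both triangles contain the same
  points, so disjointness makes them equal.\<close>

lemma side_at_overlap:
  assumes P: "side_at s p u a b r P" and Q: "side_at s p u a' b' r' Q" and "max a a' < min b b'"
  shows "P = Q" "a = a'" "b = b'"
proof -
  define m where "m = (max a a' + min b b') / 2"
  have m: "a < m" "m < b" "a' < m" "m < b'" using assms(3) by (auto simp: m_def)
  have "0 < s * cr u (r - p)" using P by (auto simp: side_at_def)
  then have "\<forall>\<^sub>F t in at_right 0. p + m *\<^sub>R u + t *\<^sub>R (r - p) \<in> P \<and> p + m *\<^sub>R u + t *\<^sub>R (r - p) \<in> Q"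
    using side_at_near[OF P m(1,2)] side_at_near[OF Q m(3,4)] by (simp add: eventually_conj)
  then have "P \<inter> Q \<noteq> {}" by (auto dest!: eventually_happens)
  then show PQ: "P = Q" using disjoint P Q by (auto simp: side_at_def)
  have "a \<le> k \<and> k \<le> b \<longleftrightarrow> a' \<le> k \<and> k \<le> b'" for k
    using side_at_line(2)[OF P, of k] side_at_line(2)[OF Q, of k] PQ by simp
  from this[of a] this[of b] this[of a'] this[of b'] show "a = a'" "b = b'"
    using P Q by (auto simp: side_at_def)
qed

lemma side_at_rebase:
  assumes P: "side_at s p u a b r P" and q: "q = p + m *\<^sub>R u" and v: "v = k *\<^sub>R u" and "0 < k"
  shows "side_at s q v ((a - m) / k) ((b - m) / k) r P"
proof -
  have "cr v (r - q) = k * cr u (r - p)" by (simp add: q v cr_diff algebra_simps)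
  then have "0 < s * cr v (r - q) \<longleftrightarrow> 0 < s * cr u (r - p)"
    using \<open>0 < k\<close> by (simp add: zero_less_mult_iff mult_less_0_iff)
  moreover have "q + ((x - m) / k) *\<^sub>R v = p + x *\<^sub>R u" for x
  proof -
    have "((x - m) / k) *\<^sub>R v = (x - m) *\<^sub>R u" using \<open>0 < k\<close> by (simp add: v)
    then show ?thesis by (simp add: q algebra_simps)
  qed
  ultimately show ?thesis
    using P \<open>0 < k\<close> by (auto simp: side_at_def divide_strict_right_mono)
qed

lemma side_at_sign:
  assumes "side_at s p u a b r P" "0 < s * s'"
  shows "side_at s' p u a b r P"
  using assms by (auto simp: side_at_def zero_less_mult_iff)

lemma side_at_extreme:
  assumes "side_at s p u a b r P"
  shows "(p + a *\<^sub>R u) extreme_point_of closure P" "(p + b *\<^sub>R u) extreme_point_of closure P"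
proof -
  let ?x = "p + a *\<^sub>R u" and ?y = "p + b *\<^sub>R u"
  have "r - ?x = (r - p) - a *\<^sub>R u" "?y - ?x = (b - a) *\<^sub>R u" by (simp_all add: algebra_simps)
  then have "cr (?y - ?x) (r - ?x) = (b - a) * cr u (r - p)"
    by (simp only:) (simp add: cr_diff algebra_simps)
  then have nc: "cr (?y - ?x) (r - ?x) \<noteq> 0" using assms by (auto simp: side_at_def)
  then have cl: "closure P = convex hull {?x, ?y, r}"
    using assms closure_tri by (auto simp: side_at_def)
  have "\<not> affine_dependent {?x, ?y, r}"
    using nc collinear_iff_cr[of ?x ?y r] by (auto simp: collinear_3_eq_affine_dependent)
  then show "?x extreme_point_of closure P" "?y extreme_point_of closure P"
    unfolding cl by (simp_all add: extreme_point_of_convex_hull_affine_independent)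
qed

lemma side_at_of_tri:
  assumes "tri x y z \<in> R" "cr (y - x) (z - x) \<noteq> 0"
  shows "side_at (sgn (cr (y - x) (z - x))) x (y - x) 0 1 z (tri x y z)"
  using assms by (simp add: side_at_def sgn_if)

text \<open>Some barycentric weight of \<open>q\<close> vanishes, since \<open>q\<close> is not
  interior, and the two others are positive, since \<open>q\<close> is not a corner. The frame is
  anchored at \<open>q\<close> itself.\<close>

lemma frontier_point_on_side:
  assumes G: "G \<in> R" and q: "q \<in> closure G" "q \<notin> G" "\<not> q extreme_point_of closure G"
  obtains s u a b r where "side_at s q u a b r G" "a < 0" "0 < b"
proof -
  note result = that
  have *: thesis if G: "G = tri x y z" and nc: "cr (y - x) (z - x) \<noteq> 0"
    and l: "0 \<le> \<alpha>" "0 \<le> \<beta>" "\<alpha> + \<beta> = 1" and q: "q = \<alpha> *\<^sub>R x + \<beta> *\<^sub>R y" for x y z \<alpha> \<beta>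
  proof -
    note S = side_at_of_tri[OF _ nc, folded G, OF \<open>G \<in> R\<close>]
    have "\<alpha> = 1 - \<beta>" using l by simp
    then have q': "q = x + \<beta> *\<^sub>R (y - x)" unfolding q by (simp only:) (simp add: algebra_simps)
    have "q \<noteq> x + 0 *\<^sub>R (y - x)" "q \<noteq> x + 1 *\<^sub>R (y - x)"
      using side_at_extreme[OF S] \<open>\<not> q extreme_point_of closure G\<close> by metis+
    then have "\<beta> \<noteq> 0" "\<beta> \<noteq> 1" unfolding q' by auto
    moreover have "side_at (sgn (cr (y - x) (z - x))) q (y - x) (- \<beta>) (1 - \<beta>) z G"
      using side_at_rebase[OF S q', of "y - x" 1] by simp
    ultimately show thesis using l by (intro result) auto
  qed
  obtain x y z where xyz: "G = tri x y z" "cr (y - x) (z - x) \<noteq> 0" using G by (rule region_tri)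
  obtain \<alpha> \<beta> \<gamma> where c: "0 \<le> \<alpha>" "0 \<le> \<beta>" "0 \<le> \<gamma>" "\<alpha> + \<beta> + \<gamma> = 1"
    and qe: "q = \<alpha> *\<^sub>R x + \<beta> *\<^sub>R y + \<gamma> *\<^sub>R z"
    using q(1) closure_tri[OF xyz(2)] unfolding xyz(1) convex_hull_3 by auto
  have "\<not> collinear {x, y, z}" using xyz(2) collinear_iff_cr by blast
  then have "\<not> (0 < \<alpha> \<and> 0 < \<beta> \<and> 0 < \<gamma>)"
    using q(2) c(4) qe unfolding xyz(1) by (auto simp: interior_convex_hull_3_minimal)
  then consider "\<alpha> = 0" | "\<beta> = 0" | "\<gamma> = 0" using c by linarith
  then show thesis
  proof cases
    case 1
    show thesis
    proof (rule *[of y z x \<beta> \<gamma>])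
      show "G = tri y z x" using xyz(1) by (simp add: insert_commute)
      show "cr (z - y) (x - y) \<noteq> 0" using xyz(2) by (simp add: cr_def algebra_simps)
    qed (use 1 c qe in auto)
  next
    case 2
    show thesis
    proof (rule *[of x z y \<alpha> \<gamma>])
      show "G = tri x z y" using xyz(1) by (simp add: insert_commute)
      show "cr (z - x) (y - x) \<noteq> 0" using xyz(2) by (simp add: cr_def algebra_simps)
    qed (use 2 c qe in auto)
  next
    case 3
    show thesis by (rule *[OF xyz]) (use 3 c qe in auto)
  qed
qed

text \<open>The point at \<open>t0\<close> may be a corner of triangles across the line, but a point
  \<open>q\<close> slightly further on is a corner of none of them. The triangle reached from
  \<open>q\<close> away from \<open>T\<close> therefore has \<open>q\<close> inside one of its
  sides, and this side must run along the line.\<close>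

lemma across_forward:
  assumes T: "side_at s p u c d z T" and t: "c \<le> t0" "t0 < d"
  obtains a b r N where "side_at (- s) p u a b r N" "a \<le> t0" "t0 < b"
proof -
  have u: "u \<noteq> 0" and cuz: "0 < s * cr u (z - p)" using T by (auto simp: side_at_def)
  have Tr: "T \<in> R" using T by (auto simp: side_at_def)
  define near where "near = {P \<in> R. closure P \<inter> cball p (max \<bar>t0\<bar> \<bar>d\<bar> * norm u) \<noteq> {}}"
  define E where "E = (\<Union>P\<in>near. {x. x extreme_point_of closure P})"
  have "finite {x. x extreme_point_of closure P}" if "P \<in> near" for P
  proof -
    have "P \<in> R" using that by (simp add: near_def)
    then obtain x y z where xyz: "P = tri x y z" "cr (y - x) (z - x) \<noteq> 0" by (rule region_tri)
    have "{e. e extreme_point_of closure P} \<subseteq> {x, y, z}"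
      unfolding xyz(1) closure_tri[OF xyz(2)] by (rule extreme_points_of_convex_hull)
    then show ?thesis by (rule finite_subset) simp
  qed
  then have finE: "finite E" unfolding E_def near_def using finite_near by blast
  define F where "F = {k. t0 < k \<and> p + k *\<^sub>R u \<in> E}"
  have "finite ((\<lambda>k. p + k *\<^sub>R u) -` E)"
    by (rule finite_vimageI[OF finE]) (use u in \<open>auto simp: inj_on_def\<close>)
  then have finF: "finite F" by (rule rev_finite_subset) (auto simp: F_def)
  \<comment> \<open>Halfway from \<open>t0\<close> to \<open>d\<close> or to the next corner on the
    line, whichever comes first: no nearby triangle has a corner at a coordinate in
    \<open>(t0, m]\<close>.\<close>
  define m where "m = (t0 + Min (insert d F)) / 2"
  have "t0 < Min (insert d F)" using finF t by (auto simp: F_def)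
  moreover have "Min (insert d F) \<le> d" using finF by simp
  ultimately have m: "t0 < m" "m < d" "m < Min (insert d F)" by (auto simp: m_def)
  have noF: "t0 < k \<Longrightarrow> p + k *\<^sub>R u \<in> E \<Longrightarrow> m < k" for k
    using m(3) finF by (auto simp: F_def)
  have inE: "k \<le> t0 \<or> m < k" if "P \<in> R" "(p + k *\<^sub>R u) extreme_point_of closure P" "k \<le> m" for k P
  proof (rule ccontr)
    assume "\<not> ?thesis"
    then have k: "t0 < k" "k \<le> m" by auto
    then have "\<bar>k\<bar> \<le> max \<bar>t0\<bar> \<bar>d\<bar>" using m by auto
    then have "p + k *\<^sub>R u \<in> cball p (max \<bar>t0\<bar> \<bar>d\<bar> * norm u)"
      by (simp add: dist_norm mult_right_mono)
    moreover have "p + k *\<^sub>R u \<in> closure P" using that by (simp add: extreme_point_of_def)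
    ultimately have "P \<in> near" using that by (auto simp: near_def)
    then have "p + k *\<^sub>R u \<in> E" using that by (auto simp: E_def)
    then show False using noF k by force
  qed
  define q where "q = p + m *\<^sub>R u"
  obtain G \<epsilon> where G: "G \<in> R" "\<epsilon> > 0" "\<And>t. \<lbrakk>0 \<le> t; t \<le> \<epsilon>\<rbrakk> \<Longrightarrow> q + t *\<^sub>R (- (z - p)) \<in> closure G"
    by (rule region_in_direction[of q "- (z - p)"]) blast
  have "G \<noteq> T"
  proof
    assume "G = T"
    then have "p + m *\<^sub>R u + (- \<epsilon>) *\<^sub>R (z - p) \<in> closure T"
      using G(2) G(3)[of \<epsilon>] by (simp add: q_def algebra_simps)
    then show False using side_at_mem(2)[OF T, of m "- \<epsilon>"] G(2) by simp
  qed
  then have GT: "x \<in> closure T \<Longrightarrow> x \<notin> G" for x using region_closure_eq G(1) Tr by blast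
  have qT: "p + k *\<^sub>R u \<in> closure T" if "c \<le> k" "k \<le> d" for k
    using side_at_line(2)[OF T] that by simp
  have qG: "q \<in> closure G" using G(3)[of 0] G(2) by simp
  have "\<not> q extreme_point_of closure G" using inE[OF G(1), of m] m unfolding q_def by auto
  then obtain s' v a b r where S: "side_at s' q v a b r G" "a < 0" "0 < b"
  proof -
    have "q \<notin> G" using GT qT[of m] m t unfolding q_def by auto
    then show thesis
      using frontier_point_on_side[OF G(1) qG] \<open>\<not> q extreme_point_of closure G\<close> that by blast
  qed
  \<comment> \<open>If the side of \<open>G\<close> through \<open>q\<close> were transversal to
    \<open>u\<close>, the line would enter \<open>G\<close> next to \<open>q\<close>, where all its
    points belong to the closure of \<open>T\<close>.\<close>
  have "cr v u = 0"
  proof (rule ccontr)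
    assume nz: "cr v u \<noteq> 0"
    have s': "s' \<noteq> 0" using S(1) by (auto simp: side_at_def)
    define \<sigma> where "\<sigma> = sgn (s' * cr v u)"
    have \<sigma>: "\<bar>\<sigma>\<bar> = 1" "0 < s' * cr v (\<sigma> *\<^sub>R u)"
      using nz s' by (auto simp: \<sigma>_def sgn_if zero_less_mult_iff mult_less_0_iff)
    have "\<forall>\<^sub>F t in at_right 0. q + t *\<^sub>R (\<sigma> *\<^sub>R u) \<in> G"
      using side_at_near[OF S \<sigma>(2)] by simp
    moreover have "\<forall>\<^sub>F t in at_right 0. t < min (m - c) (d - m)"
      using m t by (intro eventually_at_rightI[of 0 "min (m - c) (d - m)"]) auto
    ultimately have "\<forall>\<^sub>F t in at_right (0::real). False"
      using eventually_at_right_less[of 0]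
    proof eventually_elim
      case (elim t)
      have "\<bar>t * \<sigma>\<bar> = t" using \<sigma>(1) elim by (simp add: abs_mult)
      then have "p + (m + t * \<sigma>) *\<^sub>R u \<in> closure T" using elim by (intro qT) auto
      then show ?case using GT elim by (simp add: q_def algebra_simps)
    qed
    then show False by simp
  qed
  moreover have "v \<noteq> 0" using S(1) by (auto simp: side_at_def)
  ultimately obtain k where k: "u = k *\<^sub>R v" by (rule cr_zero_parallel)
  have k0: "k \<noteq> 0" using k u by auto
  \<comment> \<open>The side of \<open>G\<close> may be directed against \<open>u\<close>; in that
    case the frame is reversed before it is rescaled.\<close>
  obtain s1 a1 b1 where N: "side_at s1 p u a1 b1 r G" "a1 < m" "m < b1"
  proof (cases "0 < k")
    case True
    show ?thesis
      by (rule that, rule side_at_rebase[OF S(1) _ k True, of p "- m * k"])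
        (use True S in \<open>auto simp: q_def k field_simps\<close>)
  next
    case False
    then have k': "0 < - k" using k0 by simp
    have *: "u = (- k) *\<^sub>R (- v)" using k by simp
    show ?thesis
      by (rule that, rule side_at_rebase[OF S(1)[THEN side_at_reverse[THEN iffD1]] _ * k', of p "m * k"])
        (use k' S in \<open>auto simp: q_def k field_simps\<close>)
  qed
  \<comment> \<open>The segment leaving \<open>q\<close> away from \<open>T\<close> lies in the
    closure of \<open>G\<close>, which decides on which side of the line \<open>G\<close>
    lies.\<close>
  have "q + \<epsilon> *\<^sub>R (- (z - p)) - p = m *\<^sub>R u - \<epsilon> *\<^sub>R (z - p)"
    by (simp add: q_def algebra_simps)
  then have "0 \<le> s1 * cr u (m *\<^sub>R u - \<epsilon> *\<^sub>R (z - p))"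
    using side_at_closure_half_plane[OF N(1) G(3)[of \<epsilon>]] G(2) by simp
  then have "\<epsilon> * (s1 * cr u (z - p)) \<le> 0" by (simp add: cr_diff algebra_simps)
  then have "s1 * cr u (z - p) \<le> 0" using G(2) by (simp add: mult_le_0_iff)
  moreover have "s1 \<noteq> 0" using N(1) by (auto simp: side_at_def)
  ultimately have "0 < s1 * (- s)"
    using cuz G(2) by (auto simp: zero_less_mult_iff mult_le_0_iff mult_less_0_iff)
  then have "side_at (- s) p u a1 b1 r G" by (rule side_at_sign[OF N(1)])
  moreover have "a1 \<le> t0" using inE[OF G(1) side_at_extreme(1)[OF N(1)]] N(2) by auto
  ultimately show thesis using that N(3) m by force
qed

lemma across_backward:
  assumes T: "side_at s p u c d z T" and t: "c < t0" "t0 \<le> d"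
  obtains a b r N where "side_at (- s) p u a b r N" "a < t0" "t0 \<le> b"
proof -
  obtain a b r N where N: "side_at (- (- s)) p (- u) a b r N" "a \<le> - t0" "- t0 < b"
    by (rule across_forward[OF T[THEN side_at_reverse[THEN iffD1]], of "- t0"]) (use t in auto)
  have "side_at (- s) p u (- b) (- a) r N" using N(1) side_at_reverse[of "- s" p u] by simp
  then show thesis using that N by force
qed

end

section \<open>Tilings with at most three triangles at each point\<close>

lemma inner_pos_combination:
  assumes ab: "0 < (a :: real ^ 2) \<bullet> b"
    and w: "w = s *\<^sub>R a + t *\<^sub>R b" "0 \<le> s" "0 \<le> t" "w \<noteq> 0"
    and v: "v = s' *\<^sub>R a + t' *\<^sub>R b" "0 \<le> s'" "0 \<le> t'" "v \<noteq> 0"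
  shows "0 < w \<bullet> v"
proof -
  have a: "0 < a \<bullet> a" "0 < b \<bullet> b" using ab by auto
  have "w \<bullet> v = (s * s') * (a \<bullet> a) + (s * t' + t * s') * (a \<bullet> b) + (t * t') * (b \<bullet> b)"
    by (simp add: w(1) v(1) inner_add_left inner_add_right inner_commute algebra_simps)
  moreover have "s \<noteq> 0 \<or> t \<noteq> 0" "s' \<noteq> 0 \<or> t' \<noteq> 0" using w(1,4) v(1,4) by auto
  then have "0 < s \<or> 0 < t" "0 < s' \<or> 0 < t'" using w(2,3) v(2,3) by linarith+
  then have "0 < s * s' \<or> 0 < s * t' + t * s' \<or> 0 < t * t'"
    using mult_pos_pos[of s s'] mult_pos_pos[of s t'] mult_pos_pos[of t s'] mult_pos_pos[of t t']
      mult_nonneg_nonneg[of s t'] mult_nonneg_nonneg[of t s'] w(2,3) v(2,3) by argo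
  then have "0 < (s * s') * (a \<bullet> a) \<or> 0 < (s * t' + t * s') * (a \<bullet> b) \<or> 0 < (t * t') * (b \<bullet> b)"
    using a ab by (meson mult_pos_pos)
  moreover have "0 \<le> (s * s') * (a \<bullet> a)" "0 \<le> (s * t' + t * s') * (a \<bullet> b)" "0 \<le> (t * t') * (b \<bullet> b)"
    using a ab w(2,3) v(2,3) by (simp_all add: add_nonneg_nonneg)
  ultimately show ?thesis by linarith
qed

text \<open>For independent \<open>a\<close> and \<open>b\<close> this is the closed cone they span:
  the two quotients are the coefficients of \<open>w\<close> by Cramer's rule.\<close>

definition sector :: "real ^ 2 \<Rightarrow> real ^ 2 \<Rightarrow> (real ^ 2) set" where
  "sector a b = {w. 0 \<le> cr w b / cr a b \<and> 0 \<le> cr a w / cr a b}"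

lemma closed_sector: "closed (sector a b)"
  unfolding sector_def cr_def divide_inverse
  by (intro closed_Collect_conj closed_Collect_le continuous_intros)

lemma inner_pos_sector:
  assumes "0 < a \<bullet> b" "cr a b \<noteq> 0" "w \<in> sector a b" "v \<in> sector a b" "w \<noteq> 0" "v \<noteq> 0"
  shows "0 < w \<bullet> v"
  using inner_pos_combination[OF assms(1) cramer[OF assms(2), of w] _ _ _ cramer[OF assms(2), of v]] assms
  by (simp add: sector_def)

lemma direction_in_sector:
  assumes n: "cr (y - p) (z - p) \<noteq> 0" and "0 < t" "p + t *\<^sub>R w \<in> closure (tri p y z)"
  shows "w \<in> sector (y - p) (z - p)"
proof -
  have "p + t *\<^sub>R w \<in> convex hull {p, y, z}" using assms(3) closure_tri[OF n] by simp
  then obtain \<alpha> \<beta> \<gamma> where c: "0 \<le> \<beta>" "0 \<le> \<gamma>" "\<alpha> + \<beta> + \<gamma> = 1"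
    and e: "p + t *\<^sub>R w = \<alpha> *\<^sub>R p + \<beta> *\<^sub>R y + \<gamma> *\<^sub>R z"
    unfolding convex_hull_3 by auto
  have "\<alpha> = 1 - \<beta> - \<gamma>" using c by simp
  then have "t *\<^sub>R w = \<beta> *\<^sub>R (y - p) + \<gamma> *\<^sub>R (z - p)"
    using e by (simp only:) (simp add: algebra_simps)
  then have "(1 / t) *\<^sub>R (t *\<^sub>R w) = (1 / t) *\<^sub>R (\<beta> *\<^sub>R (y - p) + \<gamma> *\<^sub>R (z - p))" by simp
  then have "w = (\<beta> / t) *\<^sub>R (y - p) + (\<gamma> / t) *\<^sub>R (z - p)"
    using assms(2) by (simp add: scaleR_add_right)
  then have "cr w (z - p) = (\<beta> / t) * cr (y - p) (z - p)" "cr (y - p) w = (\<gamma> / t) * cr (y - p) (z - p)"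
    by simp_all
  then show ?thesis using n c assms(2) by (simp add: sector_def)
qed

text \<open>The inner products at the two ends of a side add up to its squared length, so a triangle
  has at most one angle that is not acute.\<close>

lemma corner_angles:
  fixes x y z :: "'a::real_inner"
  assumes "\<not> 0 < (y - x) \<bullet> (z - x)" "y \<noteq> x"
  shows "0 < (x - y) \<bullet> (z - y)"
proof -
  have "0 < (y - x) \<bullet> (y - x)" using assms(2) by simp
  moreover have "(x - y) \<bullet> (z - y) = (y - x) \<bullet> (y - x) - (y - x) \<bullet> (z - x)"
    by (simp add: inner_diff_left inner_diff_right inner_commute)
  ultimately show ?thesis using assms(1) by linarith
qed

context triangle_tiling
begin

definition corner_at :: "real ^ 2 \<Rightarrow> real ^ 2 \<Rightarrow> real ^ 2 \<Rightarrow> (real ^ 2) set \<Rightarrow> bool" where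
  "corner_at p y z P \<longleftrightarrow> P \<in> R \<and> P = tri p y z \<and> cr (y - p) (z - p) \<noteq> 0"

lemma corner_at_permute:
  "corner_at y x z P \<longleftrightarrow> corner_at x y z P" "corner_at x z y P \<longleftrightarrow> corner_at x y z P"
proof -
  have "cr (x - y) (z - y) = - cr (y - x) (z - x)" "cr (z - x) (y - x) = - cr (y - x) (z - x)"
    by (simp_all add: cr_def algebra_simps)
  then show "corner_at y x z P \<longleftrightarrow> corner_at x y z P" "corner_at x z y P \<longleftrightarrow> corner_at x y z P"
    unfolding corner_at_def by (simp_all add: tri_permute)
qed

lemma side_at_corner:
  assumes "side_at s p u a b r P"
  shows "corner_at (p + a *\<^sub>R u) (p + b *\<^sub>R u) r P"
proof -
  let ?x = "p + a *\<^sub>R u" and ?y = "p + b *\<^sub>R u"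
  have "cr (?y - ?x) (r - ?x) = (b - a) * cr u (r - p)"
    by (simp add: cr_diff algebra_simps)
  then have "cr (?y - ?x) (r - ?x) \<noteq> 0" using assms by (auto simp: side_at_def)
  then show ?thesis using assms unfolding side_at_def corner_at_def by blast
qed

lemma corner_at_side:
  assumes "corner_at x y z P" "0 < s * cr (y - x) (z - x)"
  shows "side_at s x (y - x) 0 1 z P"
  using assms unfolding corner_at_def side_at_def by auto

lemma side_at_opposite:
  assumes "side_at s p u a b r P" "side_at s' p u a' b' r' P'" "s * s' < 0"
  shows "P \<noteq> P'"
proof
  assume "P = P'"
  have "r \<in> closure P" using side_at_mem(2)[OF assms(1), of 0 1] by simp
  then have "0 \<le> s' * cr u (r - p)"
    using side_at_closure_half_plane[OF assms(2)] \<open>P = P'\<close> by simp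
  moreover have "0 < s * cr u (r - p)" using assms(1) by (simp add: side_at_def)
  ultimately show False using assms(3)
    by (auto simp: zero_less_mult_iff zero_le_mult_iff mult_less_0_iff)
qed

lemma side_at_unique:
  assumes "side_at s p u a b r P" "side_at s' p u a' b' r' P"
  shows "a = a'" "b = b'"
proof -
  have "a \<le> k \<and> k \<le> b \<longleftrightarrow> a' \<le> k \<and> k \<le> b'" for k
    using side_at_line(2)[OF assms(1), of k] side_at_line(2)[OF assms(2), of k] by simp
  from this[of a] this[of b] this[of a'] this[of b'] show "a = a'" "b = b'"
    using assms by (auto simp: side_at_def)
qed

text \<open>At a crossing of two such sides, points of one side would be interior to the other
  triangle. Two overhangs at one corner are refuted this way.\<close>

lemma two_flat_angles:
  assumes P: "side_at s p u a b r P" "a < c" "c < b" and Q: "side_at s' q v a' b' r' Q" "a' < c'" "c' < b'"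
    and e: "p + c *\<^sub>R u = q + c' *\<^sub>R v" and n: "cr u v \<noteq> 0"
  shows False
proof -
  have s: "s \<noteq> 0" using P(1) by (auto simp: side_at_def)
  have PQr: "P \<in> R" "Q \<in> R" using P(1) Q(1) by (auto simp: side_at_def)
  define \<sigma> where "\<sigma> = sgn (s * cr u v)"
  have \<sigma>: "\<bar>\<sigma>\<bar> = 1" "0 < s * cr u (\<sigma> *\<^sub>R v)"
    using n s by (auto simp: \<sigma>_def sgn_if zero_less_mult_iff mult_less_0_iff)
  have "\<forall>\<^sub>F t in at_right 0. p + c *\<^sub>R u + t *\<^sub>R (\<sigma> *\<^sub>R v) \<in> P"
    by (rule side_at_near[OF P \<sigma>(2)])
  moreover have "\<forall>\<^sub>F t in at_right 0. t < min (c' - a') (b' - c')"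
    using Q by (intro eventually_at_rightI[of 0 "min (c' - a') (b' - c')"]) auto
  ultimately have "\<forall>\<^sub>F t in at_right (0::real). False"
    using eventually_at_right_less[of 0]
  proof eventually_elim
    case (elim t)
    have "\<bar>t * \<sigma>\<bar> = t" using \<sigma>(1) elim by (simp add: abs_mult)
    then have "a' \<le> c' + t * \<sigma> \<and> c' + t * \<sigma> \<le> b'" using elim by linarith
    then have "q + (c' + t * \<sigma>) *\<^sub>R v \<in> closure Q" by (simp only: side_at_line(2)[OF Q(1)])
    moreover have "p + c *\<^sub>R u + t *\<^sub>R (\<sigma> *\<^sub>R v) = q + (c' + t * \<sigma>) *\<^sub>R v"
      unfolding e by (simp add: algebra_simps)
    with elim have "q + (c' + t * \<sigma>) *\<^sub>R v \<in> P" by simp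
    ultimately have "P = Q" using region_closure_eq PQr by blast
    then show ?case using \<open>q + (c' + t * \<sigma>) *\<^sub>R v \<in> P\<close> side_at_line(1)[OF Q(1)] by simp
  qed
  then show False by simp
qed

lemma corner_at_extreme:
  assumes "corner_at x y z P"
  shows "{e. e extreme_point_of closure P} = {x, y, z}"
proof -
  have P: "P = tri x y z" "cr (y - x) (z - x) \<noteq> 0" using assms by (auto simp: corner_at_def)
  have "\<not> affine_dependent {x, y, z}"
    using P(2) collinear_iff_cr[of x y z] by (auto simp: collinear_3_eq_affine_dependent)
  then show ?thesis
    unfolding P(1) closure_tri[OF P(2)] by (auto simp: extreme_point_of_convex_hull_affine_independent)
qed

lemma side_at_unique_apex:
  assumes P: "side_at s p u a b r P" "side_at s' p u a b r' P"
  shows "r = r'"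
proof -
  have c: "corner_at (p + a *\<^sub>R u) (p + b *\<^sub>R u) r P" "corner_at (p + a *\<^sub>R u) (p + b *\<^sub>R u) r' P"
    using P side_at_corner by blast+
  then have "r \<notin> {p + a *\<^sub>R u, p + b *\<^sub>R u}" by (auto simp: corner_at_def)
  then show ?thesis using corner_at_extreme[OF c(1)] corner_at_extreme[OF c(2)] by auto
qed

lemma finite_side_at_near:
  assumes "c < d"
  shows "finite {P. \<exists>a b r. side_at s p u a b r P \<and> a < d \<and> c < b}"
proof -
  let ?F = "{P \<in> R. closure P \<inter> cball p (max \<bar>c\<bar> \<bar>d\<bar> * norm u) \<noteq> {}}"
  have "P \<in> ?F" if P: "side_at s p u a b r P" "a < d" "c < b" for a b r P
  proof -
    have "a < b" "P \<in> R" using P(1) by (auto simp: side_at_def)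
    have "p + max a c *\<^sub>R u \<in> closure P"
      unfolding side_at_line(2)[OF P(1)] using P \<open>a < b\<close> by simp
    moreover have "\<bar>max a c\<bar> \<le> max \<bar>c\<bar> \<bar>d\<bar>" using P assms by linarith
    then have "p + max a c *\<^sub>R u \<in> cball p (max \<bar>c\<bar> \<bar>d\<bar> * norm u)"
      by (simp add: dist_norm mult_right_mono)
    ultimately show ?thesis using \<open>P \<in> R\<close> by blast
  qed
  then show ?thesis by (intro finite_subset[OF _ finite_near[of p "max \<bar>c\<bar> \<bar>d\<bar> * norm u"]]) blast
qed

end

locale small_degree_tiling = triangle_tiling +
  assumes degree: "card (regions_at p) \<le> 3"
begin

text \<open>A third triangle at \<open>p\<close> leaves an open half plane of directions to the two given ones. Among
  \<open>m\<close>, \<open>- m\<close> (the ends of that half plane) and its normal \<open>n\<close>, two lie in the same acute cone.\<close>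

lemma one_acute_corner:
  assumes P: "corner_at p y z P" "0 < (y - p) \<bullet> (z - p)"
    and Q: "corner_at p y' z' Q" "0 < (y' - p) \<bullet> (z' - p)"
  shows "P = Q"
proof (rule ccontr)
  assume "P \<noteq> Q"
  let ?K = "sector (y - p) (z - p)" and ?L = "sector (y' - p) (z' - p)"
  have P': "P \<in> R" "P = tri p y z" "cr (y - p) (z - p) \<noteq> 0"
    and Q': "Q \<in> R" "Q = tri p y' z'" "cr (y' - p) (z' - p) \<noteq> 0"
    using P Q by (auto simp: corner_at_def)
  have pP: "p \<in> closure P" using P' closure_tri hull_inc[of p "{p, y, z}" convex] by simp
  have pQ: "p \<in> closure Q" using Q' closure_tri hull_inc[of p "{p, y', z'}" convex] by simp
  have "card {P, Q} = 2" using \<open>P \<noteq> Q\<close> by simp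
  moreover have "{P, Q} \<subseteq> regions_at p" using P' Q' pP pQ by (simp add: regions_at_iff)
  ultimately have "card (regions_at p - {P, Q}) \<le> 1"
    using degree[of p] by (simp add: card_Diff_subset)
  then have "\<And>x y. \<lbrakk>x \<in> regions_at p - {P, Q}; y \<in> regions_at p - {P, Q}\<rbrakk> \<Longrightarrow> x = y"
    using finite_regions_at[of p] by (simp only: card_le_Suc0_iff_eq finite_Diff One_nat_def)
  then obtain S where S: "regions_at p - {P, Q} \<subseteq> {S}"
    by (metis singletonI subsetI)
  obtain n where n: "n \<noteq> 0" "\<And>x. \<lbrakk>S \<in> regions_at p - {P, Q}; x \<in> closure S\<rbrakk> \<Longrightarrow> n \<bullet> (x - p) \<le> 0"
  proof (cases "S \<in> regions_at p - {P, Q}")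
    case True
    then have Sr: "S \<in> R" "S \<noteq> P" by (auto simp: regions_at_iff)
    then have "p \<notin> S" using pP P'(1) region_closure_eq by blast
    then obtain a b where ab: "a \<noteq> 0" "a \<bullet> p \<le> b" "\<And>x. x \<in> S \<Longrightarrow> b \<le> a \<bullet> x"
      using separating_hyperplane_sets[of "{p}" S] region_convex[OF Sr(1)] region_nonempty[OF Sr(1)]
      by auto
    have "closure S \<subseteq> {x. b \<le> a \<bullet> x}"
      using ab by (intro closure_minimal closed_Collect_le continuous_intros) auto
    then show ?thesis using ab by (intro that[of "- a"]) (auto simp: inner_diff_right)
  next
    case False
    then show ?thesis using that[of "axis 1 1"] by (auto simp: axis_eq_0_iff)
  qed
  have dir: "w \<in> ?K \<union> ?L" if "0 < n \<bullet> w" for w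
  proof -
    obtain G \<epsilon> where G: "G \<in> R" "\<epsilon> > 0" "\<And>t. \<lbrakk>0 \<le> t; t \<le> \<epsilon>\<rbrakk> \<Longrightarrow> p + t *\<^sub>R w \<in> closure G"
      by (rule region_in_direction[of p w]) blast
    have Gp: "G \<in> regions_at p" using G(1,2) G(3)[of 0] by (simp add: regions_at_iff)
    have e: "p + \<epsilon> *\<^sub>R w \<in> closure G" using G(2,3) by simp
    have "G \<in> {P, Q}"
    proof (rule ccontr)
      assume "G \<notin> {P, Q}"
      then have "G = S" "S \<in> regions_at p - {P, Q}" using Gp S by auto
      then have "n \<bullet> (\<epsilon> *\<^sub>R w) \<le> 0" using n(2) e by force
      then show False using that G(2) by (simp add: mult_le_0_iff)
    qed
    then show ?thesis
      using direction_in_sector[OF P'(3) G(2), of w] direction_in_sector[OF Q'(3) G(2), of w] e P'(2) Q'(2)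
      by auto
  qed
  \<comment> \<open>Both cones are closed, so the directions bounding the half plane are covered as
    well.\<close>
  have lim: "w \<in> ?K \<union> ?L" if "n \<bullet> w = 0" for w
  proof (rule ccontr)
    assume "w \<notin> ?K \<union> ?L"
    moreover have "((\<lambda>t. w + t *\<^sub>R n) \<longlongrightarrow> w + 0 *\<^sub>R n) (at_right 0)" by (intro tendsto_intros)
    moreover have "open (- (?K \<union> ?L))" by (intro open_Compl closed_Un closed_sector)
    ultimately have "\<forall>\<^sub>F t in at_right 0. w + t *\<^sub>R n \<in> - (?K \<union> ?L)"
      by (intro topological_tendstoD) auto
    then have "\<forall>\<^sub>F t in at_right (0::real). False" using eventually_at_right_less[of 0]
    proof eventually_elim
      case (elim t)
      have "0 < n \<bullet> (w + t *\<^sub>R n)" using elim n(1) that by (simp add: inner_add_right)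
      then show ?case using dir elim by blast
    qed
    then show False by simp
  qed
  define m :: "real ^ 2" where "m = vector [- (n $ 2), n $ 1]"
  have m: "n \<bullet> m = 0" "m \<noteq> 0" using n(1)
    by (auto simp: m_def inner_vec_def sum_2 vec_eq_iff forall_2)
  have "m \<in> ?K \<union> ?L" "- m \<in> ?K \<union> ?L" "n \<in> ?K \<union> ?L" using lim dir m n(1) by auto
  moreover have *: "\<not> 0 < m \<bullet> (- m)" "\<not> 0 < n \<bullet> m" "\<not> 0 < n \<bullet> (- m)" using m by (auto simp: not_less)
  moreover have "- m \<noteq> 0" using m by simp
  ultimately show False
    using inner_pos_sector[OF P(2) P'(3), of m "- m"] inner_pos_sector[OF Q(2) Q'(3), of m "- m"]
      inner_pos_sector[OF P(2) P'(3), of n m] inner_pos_sector[OF Q(2) Q'(3), of n m]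
      inner_pos_sector[OF P(2) P'(3), of n "- m"] inner_pos_sector[OF Q(2) Q'(3), of n "- m"]
      m(2) n(1) by blast
qed

end

section \<open>Ends and angles of the triangles along a line\<close>

context triangle_tiling
begin

lemma finite_right_ends:
  assumes "c < d"
  shows "finite {b. \<exists>a r P. side_at s p u a b r P \<and> a < d \<and> c < b}"
proof -
  let ?S = "{P. \<exists>a b r. side_at s p u a b r P \<and> a < d \<and> c < b}"
  have "{b. \<exists>a r P. side_at s p u a b r P \<and> a < d \<and> c < b} \<subseteq>
      (\<lambda>P. THE b. \<exists>a r. side_at s p u a b r P) ` ?S"
  proof
    fix b assume "b \<in> {b. \<exists>a r P. side_at s p u a b r P \<and> a < d \<and> c < b}"
    then obtain a r P where P: "side_at s p u a b r P" "a < d" "c < b" by blast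
    have "(THE b. \<exists>a r. side_at s p u a b r P) = b"
      using P(1) side_at_unique(2) by blast
    then show "b \<in> (\<lambda>P. THE b. \<exists>a r. side_at s p u a b r P) ` ?S"
      using P by (intro image_eqI[of _ _ P]) auto
  qed
  then show ?thesis using finite_side_at_near[OF assms] finite_surj by blast
qed

lemma side_at_sign_square:
  assumes "side_at s p u a b r P"
  shows "s * (- s) < 0"
proof -
  have "s \<noteq> 0" using assms by (auto simp: side_at_def)
  then show ?thesis by (auto simp: zero_less_mult_iff neq_iff)
qed

lemma side_at_inner:
  "((p + b *\<^sub>R u) - (p + a *\<^sub>R u)) \<bullet> (r - (p + a *\<^sub>R u)) = (b - a) * ((r - p) \<bullet> u - a * (u \<bullet> u))"
  for p u r :: "real ^ 2"
  by (simp add: inner_diff_left inner_diff_right inner_add_left inner_add_right inner_commute algebra_simps)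

text \<open>Acuteness becomes a condition on the foot of the apex on the line, which has to lie to
  the right of the left end. All triangles along the line are thus compared in one
  coordinate.\<close>

lemma side_at_acute_left:
  assumes "side_at s p u a b r P"
  shows "0 < ((p + b *\<^sub>R u) - (p + a *\<^sub>R u)) \<bullet> (r - (p + a *\<^sub>R u)) \<longleftrightarrow> a * (u \<bullet> u) < (r - p) \<bullet> u"
proof -
  have "a < b" using assms by (auto simp: side_at_def)
  then show ?thesis unfolding side_at_inner by (simp add: zero_less_mult_iff)
qed

lemma side_at_acute_right:
  assumes "side_at s p u a b r P"
  shows "0 < ((p + a *\<^sub>R u) - (p + b *\<^sub>R u)) \<bullet> (r - (p + b *\<^sub>R u)) \<longleftrightarrow> (r - p) \<bullet> u < b * (u \<bullet> u)"
proof -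
  have "a < b" using assms by (auto simp: side_at_def)
  then show ?thesis unfolding side_at_inner by (simp add: zero_less_mult_iff)
qed

lemma side_at_acute_cases:
  assumes "side_at s p u a b r P"
  shows "a * (u \<bullet> u) < (r - p) \<bullet> u \<or> (r - p) \<bullet> u < b * (u \<bullet> u)"
proof -
  have "a < b" "0 < u \<bullet> u" using assms by (auto simp: side_at_def)
  then have "a * (u \<bullet> u) < b * (u \<bullet> u)" by simp
  then show ?thesis by linarith
qed

end

section \<open>Propagation of acute angles along a side\<close>

context small_degree_tiling
begin

lemma side_at_one_acute:
  assumes P: "side_at s p u a b r P" "(r - p) \<bullet> u < b * (u \<bullet> u)"
    and Q: "side_at s' p u b b' r' Q" "b * (u \<bullet> u) < (r' - p) \<bullet> u"
  shows False
proof -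
  have "P = Q"
    using one_acute_corner[OF corner_at_permute(1)[THEN iffD2, OF side_at_corner[OF P(1)]] _ side_at_corner[OF Q(1)]]
      side_at_acute_right[OF P(1)] side_at_acute_left[OF Q(1)] P(2) Q(2) by blast
  then show False using side_at_unique[OF P(1), of s' b b' r'] Q(1) by (auto simp: side_at_def)
qed

lemma side_at_same_end:
  assumes P: "side_at s p u a b r P" "(r - p) \<bullet> u < b * (u \<bullet> u)"
    and Q: "side_at (- s) p u a' b r' Q" "(r' - p) \<bullet> u < b * (u \<bullet> u)"
  shows False
proof -
  have "P = Q"
    using one_acute_corner[OF corner_at_permute(1)[THEN iffD2, OF side_at_corner[OF P(1)]] _
        corner_at_permute(1)[THEN iffD2, OF side_at_corner[OF Q(1)]]]
      side_at_acute_right[OF P(1)] side_at_acute_right[OF Q(1)] P(2) Q(2) by blast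
  moreover have "s * (- s) < 0" by (rule side_at_sign_square[OF P(1)])
  ultimately show False using side_at_opposite[OF P(1) Q(1)] by blast
qed

text \<open>Among the triangles across the side \<open>[c, d]\<close> not acute at their right end, consider the one
  with leftmost right end \<open>b\<close>: its left neighbour is not acute at its own right end either.\<close>

lemma acute_propagates:
  assumes T: "side_at s p u c d z T" "(z - p) \<bullet> u < d * (u \<bullet> u)"
    and N: "side_at (- s) p u a b r N" "a \<le> c" "c < b" "(r - p) \<bullet> u < b * (u \<bullet> u)"
  obtains a' b' r' M where "side_at (- s) p u a' b' r' M" "a' < d" "d < b'" "(r' - p) \<bullet> u < b' * (u \<bullet> u)"
proof -
  have cd: "c < d" using T by (auto simp: side_at_def)
  have claim: "(r1 - p) \<bullet> u < b1 * (u \<bullet> u)" if Q: "side_at (- s) p u a1 b1 r1 Q" "a1 < d" "c < b1" for a1 b1 r1 Q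
  proof (rule ccontr)
    assume bad: "\<not> ?thesis"
    define B where "B = {b. \<exists>a r P. (side_at (- s) p u a b r P \<and> a < d \<and> c < b) \<and> \<not> (r - p) \<bullet> u < b * (u \<bullet> u)}"
    have finB: "finite B" by (rule finite_subset[OF _ finite_right_ends[OF cd, of "- s" p u]]) (auto simp: B_def)
    have "b1 \<in> B" using Q bad by (auto simp: B_def)
    then have "Min B \<in> B" using finB by (intro Min_in) auto
    then obtain a2 r2 P where P: "side_at (- s) p u a2 (Min B) r2 P" "a2 < d" "c < Min B"
      "\<not> (r2 - p) \<bullet> u < Min B * (u \<bullet> u)" unfolding B_def by blast
    have a2: "a2 < Min B" using P(1) by (auto simp: side_at_def)
    show False
    proof (cases "a2 \<le> c")
      case True
      then have "max a a2 < min b (Min B)" using N P a2 by (auto simp: side_at_def)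
      then have "N = P" "a = a2" "b = Min B" using side_at_overlap[OF N(1) P(1)] by auto
      then show False using side_at_unique_apex[of "- s" p u a b r N "- s" r2] N(1,4) P(1,4) by simp
    next
      case False
      \<comment> \<open>\<open>P\<close> is acute at its left end because it is not at its right
        end. As only one corner at a point can be acute, the neighbour ending there is not acute at
        its right end, against the minimality of \<open>Min B\<close>.\<close>
      have acute: "a2 * (u \<bullet> u) < (r2 - p) \<bullet> u" using side_at_acute_cases[OF P(1)] P(4) by blast
      obtain a3 b3 r3 Q where Q: "side_at (- s) p u a3 b3 r3 Q" "a3 < a2" "a2 \<le> b3"
        by (rule across_backward[OF T(1), of a2]) (use False P in auto)
      have "b3 = a2"
      proof (rule ccontr)
        assume "b3 \<noteq> a2"
        then have "max a2 a3 < min (Min B) b3" using Q a2 by auto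
        then show False using side_at_overlap(2)[OF P(1) Q(1)] Q(2) by simp
      qed
      then have "\<not> (r3 - p) \<bullet> u < a2 * (u \<bullet> u)" using side_at_one_acute[of "- s" p u a3 a2 r3 Q] P(1) Q(1) acute
        by blast
      then have "a2 \<in> B" using Q \<open>b3 = a2\<close> False P(2) unfolding B_def by force
      then have "Min B \<le> a2" using finB by simp
      then show False using a2 by simp
    qed
  qed
  obtain a' b' r' M where M: "side_at (- s) p u a' b' r' M" "a' < d" "d \<le> b'"
    by (rule across_backward[OF T(1) cd order_refl])
  have acute: "(r' - p) \<bullet> u < b' * (u \<bullet> u)" using claim[OF M(1,2)] M(3) cd by simp
  \<comment> \<open>Ending at \<open>d\<close> would make both \<open>T\<close> and \<open>M\<close>
    acute there; hence \<open>M\<close> overhangs \<open>d\<close>.\<close>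
  have "b' \<noteq> d" using side_at_same_end[OF T] M(1) acute by blast
  then show thesis using that[OF M(1,2) _ acute] M(3) by simp
qed

text \<open>The apex of \<open>T'\<close> lies on the ray through the apex of \<open>T\<close> because \<open>T\<close>, \<open>T'\<close> and \<open>M\<close> are the only
  triangles at the common corner.\<close>

lemma continue_side:
  assumes T: "side_at s p u a c z T" and M: "side_at (- s) p u a' b' r' M" "a' < c" "c < b'"
  obtains d k T' where "side_at s p u c d (p + c *\<^sub>R u + k *\<^sub>R (z - (p + c *\<^sub>R u))) T'" "c < d" "0 < k"
proof -
  define q where "q = p + c *\<^sub>R u"
  have ac: "a < c" using T by (auto simp: side_at_def)
  obtain a1 d e T' where "side_at (- (- s)) p u a1 d e T'" and d: "a1 \<le> c" "c < d"
    by (rule across_forward[OF M(1), of c]) (use M in auto)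
  then have T1: "side_at s p u a1 d e T'" by simp
  have "a1 = c"
  proof (rule ccontr)
    assume "a1 \<noteq> c"
    then have "max a a1 < min c d" using d ac by auto
    then show False using side_at_overlap(3)[OF T T1] d by simp
  qed
  with T1 have T': "side_at s p u c d e T'" by simp
  have TT': "T \<noteq> T'" using side_at_unique(2)[OF T] T' d by blast
  have sq: "s * (- s) < 0" by (rule side_at_sign_square[OF T])
  have TM: "T \<noteq> M" "T' \<noteq> M" using side_at_opposite[OF T M(1) sq] side_at_opposite[OF T' M(1) sq] by blast+
  have TR: "T \<in> R" "T' \<in> R" "M \<in> R" using T T' M by (auto simp: side_at_def)
  have "q \<in> closure T" "q \<in> closure T'" "q \<in> closure M"
    unfolding q_def side_at_line(2)[OF T] side_at_line(2)[OF T'] side_at_line(2)[OF M(1)]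
    using ac d M by auto
  then have "{T, T', M} \<subseteq> regions_at q" using TR by (simp add: regions_at_iff)
  moreover have "card {T, T', M} = 3" using TT' TM by simp
  ultimately have at_q: "regions_at q = {T, T', M}"
    using card_seteq[OF finite_regions_at, of "{T, T', M}" q] degree[of q] by simp
  define X where "X = p + a *\<^sub>R u"
  have "corner_at X q z T" using side_at_corner[OF T] by (simp add: X_def q_def)
  then have corner: "corner_at q z X T" using corner_at_permute by blast
  \<comment> \<open>The side from \<open>q\<close> to \<open>z\<close> becomes the base of a second
    frame. The triangle \<open>N\<close> across it can only be \<open>T'\<close>: \<open>T\<close>
    lies on the other side of this base, and \<open>M\<close> on the other side of the original
    line.\<close>
  define s1 where "s1 = sgn (cr (z - q) (X - q))"
  have "0 < s1 * cr (z - q) (X - q)" using corner by (auto simp: corner_at_def s1_def sgn_if)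
  then have S: "side_at s1 q (z - q) 0 1 X T" by (rule corner_at_side[OF corner])
  obtain a2 b2 r2 N where N: "side_at (- s1) q (z - q) a2 b2 r2 N" "a2 \<le> 0" "0 < b2"
    by (rule across_forward[OF S, of 0]) auto
  have "N \<noteq> T" using side_at_opposite[OF S N(1) side_at_sign_square[OF S]] by blast
  have qz: "cr u (z - q) = cr u (z - p)" by (simp add: q_def cr_diff)
  have uz: "0 < s * cr u (z - p)" using T by (auto simp: side_at_def)
  define x where "x = q + b2 *\<^sub>R (z - q)"
  have xN: "x \<in> closure N" unfolding x_def side_at_line(2)[OF N(1)] using N by simp
  have "x - p = c *\<^sub>R u + b2 *\<^sub>R (z - q)" by (simp add: x_def q_def)
  then have ux: "cr u (x - p) = b2 * cr u (z - p)" by (simp add: qz)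
  have "N \<noteq> M"
  proof
    assume "N = M"
    then have "0 \<le> (- s) * cr u (x - p)" using side_at_closure_half_plane[OF M(1)] xN by blast
    then have "b2 * (s * cr u (z - p)) \<le> 0" by (simp add: ux algebra_simps)
    then show False using uz N(3) by (auto simp: mult_le_0_iff zero_less_mult_iff)
  qed
  have "q + 0 *\<^sub>R (z - q) \<in> closure N" unfolding side_at_line(2)[OF N(1)] using N by simp
  then have "N \<in> regions_at q" using N(1) by (auto simp: regions_at_iff side_at_def)
  then have NT': "N = T'" using at_q \<open>N \<noteq> T\<close> \<open>N \<noteq> M\<close> by blast
  have ue: "0 < s * cr u (e - p)" using T' by (auto simp: side_at_def)
  then have ue': "cr u (e - p) \<noteq> 0" by auto
  obtain m g where mg: "x - p = m *\<^sub>R u + g *\<^sub>R (e - p)" using cramer[OF ue'] by blast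
  have xe: "x = p + m *\<^sub>R u + g *\<^sub>R (e - p)" using mg by (simp add: algebra_simps)
  have cl: "0 \<le> g" "c * (1 - g) \<le> m" "m \<le> d * (1 - g)"
    using xN[unfolded NT' xe side_at_mem(2)[OF T']] by auto
  have "g * (s * cr u (e - p)) = b2 * (s * cr u (z - p))"
  proof -
    have "cr u (m *\<^sub>R u + g *\<^sub>R (e - p)) = g * cr u (e - p)" by simp
    then have "g * cr u (e - p) = b2 * cr u (z - p)" using ux unfolding mg by simp
    then show ?thesis by (simp add: ac_simps)
  qed
  moreover have "0 < b2 * (s * cr u (z - p))" using uz N(3) by (rule mult_pos_pos[rotated])
  ultimately have "0 < g * (s * cr u (e - p))" by (simp only:)
  then have g: "0 < g" using ue by (simp add: zero_less_mult_iff)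
  \<comment> \<open>Otherwise the midpoint of \<open>q\<close> and \<open>x\<close> would be
    interior to \<open>T'\<close>, although it lies on the line of a side of \<open>N\<close>, which
    is \<open>T'\<close>. So \<open>x\<close> is on the ray from \<open>q\<close> through
    \<open>e\<close>, and the rays to \<open>e\<close> and to \<open>z\<close> agree.\<close>
  have "m = c * (1 - g)"
  proof (rule ccontr)
    assume "m \<noteq> c * (1 - g)"
    then have "c * (1 - g) < m" using cl by simp
    then have "0 < g / 2 \<and> c * (1 - g / 2) < (c + m) / 2 \<and> (c + m) / 2 < d * (1 - g / 2)"
      using cl g d by (auto simp: field_simps)
    then have "p + ((c + m) / 2) *\<^sub>R u + (g / 2) *\<^sub>R (e - p) \<in> T'"
      by (simp only: side_at_mem(1)[OF T'])
    moreover have "p + ((c + m) / 2) *\<^sub>R u + (g / 2) *\<^sub>R (e - p) = q + (b2 / 2) *\<^sub>R (z - q)"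
    proof -
      have "p + ((c + m) / 2) *\<^sub>R u + (g / 2) *\<^sub>R (e - p) = (1 / 2) *\<^sub>R (q + x)"
        unfolding xe q_def
        by (simp add: vec_eq_iff field_simps)
      also have "\<dots> = q + (b2 / 2) *\<^sub>R (z - q)"
        unfolding x_def by (simp add: vec_eq_iff field_simps)
      finally show ?thesis .
    qed
    ultimately show False using side_at_line(1)[OF N(1)] NT' by simp
  qed
  have "b2 *\<^sub>R (z - q) = g *\<^sub>R (e - q)"
  proof -
    have "b2 *\<^sub>R (z - q) = x - q" by (simp add: x_def)
    also have "\<dots> = g *\<^sub>R (e - q)"
      unfolding xe q_def \<open>m = c * (1 - g)\<close> by (simp add: algebra_simps)
    finally show ?thesis .
  qed
  then have "(1 / g) *\<^sub>R (g *\<^sub>R (e - q)) = (1 / g) *\<^sub>R (b2 *\<^sub>R (z - q))" by simp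
  then have "e - q = (b2 / g) *\<^sub>R (z - q)" using g by simp
  then have "e = q + (b2 / g) *\<^sub>R (z - q)" by (simp add: algebra_simps)
  then show thesis using that[of d "b2 / g" T'] T' d g N(3) unfolding q_def by simp
qed

text \<open>This is \<open>acute_propagates\<close> for two triangles on either side of a common ray
  from \<open>x\<close>, measured in multiples of \<open>y - x\<close>. It produces a triangle that
  has \<open>y\<close> inside a side.\<close>

lemma acute_propagates_corner:
  assumes T: "corner_at x y z T" "0 < (x - y) \<bullet> (z - y)"
    and N: "corner_at x y' z' N" "y' - x = k *\<^sub>R (y - x)" "0 < k" "0 < (x - y') \<bullet> (z' - y')"
    and opp: "cr (y - x) (z - x) * cr (y - x) (z' - x) < 0"
  obtains s a b r M where "side_at s x (y - x) a b r M" "a < 1" "1 < b"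
proof -
  define s where "s = sgn (cr (y - x) (z - x))"
  have s: "0 < s * cr (y - x) (z - x)" "0 < (- s) * cr (y - x) (z' - x)"
    using opp by (auto simp: s_def sgn_if mult_less_0_iff)
  have S: "side_at s x (y - x) 0 1 z T" by (rule corner_at_side[OF T(1) s(1)])
  have "0 < k * ((- s) * cr (y - x) (z' - x))" using s(2) N(3) by (rule mult_pos_pos[rotated])
  then have "0 < (- s) * cr (y' - x) (z' - x)" unfolding N(2) by (simp add: ac_simps)
  then have S': "side_at (- s) x (y' - x) 0 1 z' N" by (rule corner_at_side[OF N(1)])
  have v: "y - x = (1 / k) *\<^sub>R (y' - x)" using N(2,3) by simp
  have Sk: "side_at (- s) x (y - x) 0 k z' N"
    using side_at_rebase[OF S' _ v, of x 0] N(3) by simp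
  have yk: "x + k *\<^sub>R (y - x) = y'" using N(2) by (simp add: algebra_simps)
  show thesis
  proof (rule acute_propagates[OF S _ Sk])
    show "(z - x) \<bullet> (y - x) < 1 * ((y - x) \<bullet> (y - x))"
      using side_at_acute_right[OF S] T(2) by simp
    show "(z' - x) \<bullet> (y - x) < k * ((y - x) \<bullet> (y - x))"
      using side_at_acute_right[OF Sk] N(4) yk by simp
  qed (use N(3) that in auto)
qed

text \<open>Continuing \<open>T\<close> beyond its corner \<open>q\<close> gives \<open>T'\<close>
  with apex \<open>e\<close> on the ray from \<open>q\<close> through \<open>z\<close>; continuing
  \<open>T'\<close> beyond \<open>D\<close> gives \<open>T2\<close> with apex on the ray from
  \<open>D\<close> through \<open>e\<close>. Acuteness propagates along both rays, by
  \<open>T'\<close> and \<open>T\<close> from \<open>q\<close> and by \<open>T'\<close> and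
  \<open>T2\<close> from \<open>D\<close>, so \<open>e\<close> is overhung along two crossing lines,
  against \<open>two_flat_angles\<close>.\<close>

lemma no_acute_overhang:
  assumes T: "side_at s p u a c z T" "(z - p) \<bullet> u < c * (u \<bullet> u)"
      "0 < (p + a *\<^sub>R u - z) \<bullet> (p + c *\<^sub>R u - z)"
    and M: "side_at (- s) p u a' b' r' M" "a' < c" "c < b'" "(r' - p) \<bullet> u < b' * (u \<bullet> u)"
  shows False
proof -
  define q where "q = p + c *\<^sub>R u"
  define X where "X = p + a *\<^sub>R u"
  obtain d k T' where T'0: "side_at s p u c d (q + k *\<^sub>R (z - q)) T'" and d: "c < d" and k: "0 < k"
    using continue_side[OF T(1) M(1-3)] unfolding q_def by blast
  define e where "e = q + k *\<^sub>R (z - q)"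
  define D where "D = p + d *\<^sub>R u"
  have T': "side_at s p u c d e T'" using T'0 by (simp add: e_def)
  \<comment> \<open>The acute corner at \<open>q\<close> belongs to \<open>T\<close>, so
    \<open>T'\<close> is not acute there and is acute at \<open>D\<close> and
    \<open>e\<close>.\<close>
  have na: "\<not> c * (u \<bullet> u) < (e - p) \<bullet> u" using side_at_one_acute[OF T(1,2) T'] by blast
  have cT': "corner_at q D e T'" using side_at_corner[OF T'] by (simp add: q_def D_def)
  have naq: "\<not> 0 < (D - q) \<bullet> (e - q)" using na side_at_acute_left[OF T'] by (simp add: q_def D_def)
  have ne: "D \<noteq> q" "e \<noteq> q" "e \<noteq> D" using cT' by (auto simp: corner_at_def)
  have acD: "0 < (q - D) \<bullet> (e - D)" by (rule corner_angles[OF naq ne(1)])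
  have ace: "0 < (q - e) \<bullet> (D - e)" using corner_angles[of e q D] naq ne(2) by (simp add: inner_commute)
  have arD: "(e - p) \<bullet> u < d * (u \<bullet> u)" using acD side_at_acute_right[OF T'] by (simp add: q_def D_def)
  obtain a2 b2 r2 M' where M': "side_at (- s) p u a2 b2 r2 M'" "a2 < d" "d < b2"
    by (rule acute_propagates[OF T' arD M(1) less_imp_le[OF M(2)] M(3,4)])
  obtain f l T2 where T2: "side_at s p u d f (D + l *\<^sub>R (e - D)) T2" and f: "d < f" and l: "0 < l"
    using continue_side[OF T' M'] unfolding D_def by blast
  define g where "g = D + l *\<^sub>R (e - D)"
  define F where "F = p + f *\<^sub>R u"
  have T2': "side_at s p u d f g T2" using T2 by (simp add: g_def)
  have cT2: "corner_at D F g T2" using side_at_corner[OF T2'] by (simp add: D_def F_def)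
  have "\<not> d * (u \<bullet> u) < (g - p) \<bullet> u" using side_at_one_acute[OF T' arD T2'] by blast
  then have "\<not> 0 < (g - D) \<bullet> (F - D)"
    using side_at_acute_left[OF T2'] by (simp add: D_def F_def inner_commute)
  moreover have "g \<noteq> D" using cT2 by (auto simp: corner_at_def)
  ultimately have acg: "0 < (D - g) \<bullet> (F - g)" by (rule corner_angles)
  have cT: "corner_at X q z T" using side_at_corner[OF T(1)] by (simp add: X_def q_def)
  have ac: "a < c" using T by (auto simp: side_at_def)
  have diffs: "D - q = (d - c) *\<^sub>R u" "X - q = (a - c) *\<^sub>R u" "q - D = (c - d) *\<^sub>R u" "F - D = (f - d) *\<^sub>R u"
    by (simp_all add: D_def q_def X_def F_def algebra_simps)
  have ue: "0 < s * cr u (e - p)" using T' by (auto simp: side_at_def)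
  have w: "cr u (e - q) = cr u (e - p)" "cr u (e - D) = cr u (e - p)"
    by (simp_all add: q_def D_def cr_diff)
  have w': "cr (e - q) u = - cr u (e - p)" "cr (e - D) u = - cr u (e - p)"
    using cr_commute[of "e - q" u] cr_commute[of "e - D" u] w by simp_all
  have sqr: "0 < cr u (e - p) * cr u (e - p)" using ue by (auto simp: zero_less_mult_iff neq_iff)
  obtain s1 a1 b1 r1 M1 where M1: "side_at s1 q (e - q) a1 b1 r1 M1" "a1 < 1" "1 < b1"
  proof (rule acute_propagates_corner[of q e D T' z X T "1 / k"])
    show "corner_at q e D T'" using cT' corner_at_permute by blast
    show "corner_at q z X T" using cT corner_at_permute by blast
    show "z - q = (1 / k) *\<^sub>R (e - q)" using k by (simp add: e_def)
    \<comment> \<open>\<open>D\<close> and \<open>X\<close> are on the base line on different sides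
      of \<open>q\<close>, hence on different sides of the line through \<open>q\<close> and
      \<open>e\<close>.\<close>
    have "cr (e - q) (D - q) * cr (e - q) (X - q) = ((d - c) * (a - c)) * (cr u (e - p) * cr u (e - p))"
      unfolding diffs by (simp only: cr_linear w') (simp add: algebra_simps)
    then show "cr (e - q) (D - q) * cr (e - q) (X - q) < 0"
      using sqr d ac by (simp add: mult_less_0_iff)
  qed (use ace k T(3) in \<open>auto simp: X_def q_def inner_commute\<close>)
  obtain s3 a3 b3 r3 M2 where M2: "side_at s3 D (e - D) a3 b3 r3 M2" "a3 < 1" "1 < b3"
  proof (rule acute_propagates_corner[of D e q T' g F T2 l])
    show "corner_at D e q T'" using cT' corner_at_permute by blast
    show "corner_at D g F T2" using cT2 corner_at_permute by blast
    show "g - D = l *\<^sub>R (e - D)" by (simp add: g_def)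
    show "0 < (D - e) \<bullet> (q - e)" using ace by (simp add: inner_commute)
    have "cr (e - D) (q - D) * cr (e - D) (F - D) = ((c - d) * (f - d)) * (cr u (e - p) * cr u (e - p))"
      unfolding diffs by (simp only: cr_linear w') (simp add: algebra_simps)
    then show "cr (e - D) (q - D) * cr (e - D) (F - D) < 0"
      using sqr d f by (simp add: mult_less_0_iff)
  qed (use acg l in auto)
  have "e - q = (e - D) + (d - c) *\<^sub>R u" using diffs(1) by (simp add: algebra_simps)
  then have "cr (e - q) (e - D) = cr ((e - D) + (d - c) *\<^sub>R u) (e - D)"
    by (rule arg_cong[where f = "\<lambda>x. cr x (e - D)"])
  then have "cr (e - q) (e - D) = (d - c) * cr u (e - p)" by (simp add: w)
  then have "cr (e - q) (e - D) \<noteq> 0" using ue d by auto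
  then show False using two_flat_angles[OF M1 M2] by simp
qed

text \<open>Since \<open>T\<close> is not acute at \<open>c\<close>, it is acute at its two other
  corners. An acute right end of \<open>N\<close> would propagate along \<open>T\<close> to an
  overhang at \<open>d\<close>, which \<open>no_acute_overhang\<close> excludes.\<close>

lemma non_acute_left:
  assumes T: "side_at s p u c d e T" "\<not> c * (u \<bullet> u) < (e - p) \<bullet> u"
    and N: "side_at (- s) p u a b r N" "a \<le> c" "c < b"
  shows "\<not> (r - p) \<bullet> u < b * (u \<bullet> u)"
proof
  assume acute: "(r - p) \<bullet> u < b * (u \<bullet> u)"
  let ?x = "p + c *\<^sub>R u" and ?y = "p + d *\<^sub>R u"
  have "\<not> 0 < (?y - ?x) \<bullet> (e - ?x)" using T(2) side_at_acute_left[OF T(1)] by blast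
  moreover have "?y \<noteq> ?x" "e \<noteq> ?x" using side_at_corner[OF T(1)] by (auto simp: corner_at_def)
  ultimately have "0 < (?x - e) \<bullet> (?y - e)"
    using corner_angles[of e ?x ?y] by (simp add: inner_commute)
  have ar: "(e - p) \<bullet> u < d * (u \<bullet> u)" using side_at_acute_cases[OF T(1)] T(2) by blast
  obtain a' b' r' M where "side_at (- s) p u a' b' r' M" "a' < d" "d < b'" "(r' - p) \<bullet> u < b' * (u \<bullet> u)"
    by (rule acute_propagates[OF T(1) ar N acute])
  then show False using no_acute_overhang[OF T(1) ar \<open>0 < (?x - e) \<bullet> (?y - e)\<close>] by blast
qed

lemma non_acute_right:
  assumes T: "side_at s p u c d e T" "\<not> (e - p) \<bullet> u < d * (u \<bullet> u)"
    and N: "side_at (- s) p u a b r N" "a < d" "d \<le> b"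
  shows "\<not> a * (u \<bullet> u) < (r - p) \<bullet> u"
  using non_acute_left[OF T(1)[THEN side_at_reverse[THEN iffD1]] _ N(1)[THEN side_at_reverse[THEN iffD1]]]
    T(2) N(2,3) by simp

text \<open>If \<open>N\<close> ends at \<open>d\<close>, two acute corners would meet there. If it
  overhangs \<open>d\<close>, the continuation of \<open>T\<close> beyond \<open>d\<close> is not
  acute at \<open>d\<close>, and \<open>non_acute_left\<close> applies to this continuation.\<close>

lemma across_acute_right:
  assumes T: "side_at s p u c d e T" "(e - p) \<bullet> u < d * (u \<bullet> u)"
    and N: "side_at (- s) p u a b r N" "a < d" "d \<le> b"
  shows "\<not> (r - p) \<bullet> u < b * (u \<bullet> u)"
proof (cases "d = b")
  case True
  then show ?thesis using side_at_same_end[OF T] N(1) by blast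
next
  case False
  then have "d < b" using N by simp
  obtain f k T' where T': "side_at s p u d f (p + d *\<^sub>R u + k *\<^sub>R (e - (p + d *\<^sub>R u))) T'"
    by (rule continue_side[OF T(1) N(1,2) \<open>d < b\<close>])
  then show ?thesis using non_acute_left[OF T' _ N(1)] side_at_one_acute[OF T T'] N(2) \<open>d < b\<close> by auto
qed

lemma across_acute_left:
  assumes T: "side_at s p u c d e T" "c * (u \<bullet> u) < (e - p) \<bullet> u"
    and N: "side_at (- s) p u a b r N" "a \<le> c" "c < b"
  shows "\<not> a * (u \<bullet> u) < (r - p) \<bullet> u"
  using across_acute_right[OF T(1)[THEN side_at_reverse[THEN iffD1]] _ N(1)[THEN side_at_reverse[THEN iffD1]]]
    T(2) N(2,3) by simp

text \<open>The contradiction arises at a side with two acute ends: a triangle across it that ends inside the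
  side has a partner there, and one of the two is not acute; one that covers the side must be
  non-acute at both of its own ends.\<close>

theorem no_small_degree_tiling: False
proof -
  obtain T where TR: "T \<in> R" using cover by blast
  then obtain x0 y0 z0 where "T = tri x0 y0 z0" "cr (y0 - x0) (z0 - x0) \<noteq> 0" by (rule region_tri)
  then have c0: "corner_at x0 y0 z0 T" using TR by (simp add: corner_at_def)
  \<comment> \<open>At most one angle is not acute; naming its corner \<open>z\<close> leaves a side
    from \<open>x\<close> to \<open>y\<close> with two acute ends.\<close>
  obtain x y z where c: "corner_at x y z T" "0 < (y - x) \<bullet> (z - x)" "0 < (x - y) \<bullet> (z - y)"
  proof -
    have ne: "y0 \<noteq> x0" "z0 \<noteq> x0" "z0 \<noteq> y0" using c0 by (auto simp: corner_at_def)
    note perm = corner_at_permute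
    consider "\<not> 0 < (y0 - x0) \<bullet> (z0 - x0)" | "\<not> 0 < (x0 - y0) \<bullet> (z0 - y0)"
      | "0 < (y0 - x0) \<bullet> (z0 - x0)" "0 < (x0 - y0) \<bullet> (z0 - y0)" by blast
    then show thesis
    proof cases
      case 1
      show thesis
      proof (rule that)
        show "corner_at y0 z0 x0 T" using c0 perm by blast
        show "0 < (z0 - y0) \<bullet> (x0 - y0)" using corner_angles[OF 1] ne by (simp add: inner_commute)
        show "0 < (y0 - z0) \<bullet> (x0 - z0)"
          using corner_angles[of z0 x0 y0] 1 ne by (simp add: inner_commute)
      qed
    next
      case 2
      show thesis
      proof (rule that)
        show "corner_at x0 z0 y0 T" using c0 perm by blast
        show "0 < (z0 - x0) \<bullet> (y0 - x0)" using corner_angles[OF 2] ne by (simp add: inner_commute)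
        show "0 < (x0 - z0) \<bullet> (y0 - z0)"
          using corner_angles[of z0 y0 x0] 2 ne by (simp add: inner_commute)
      qed
    next
      case 3
      then show thesis using that c0 by blast
    qed
  qed
  define s where "s = sgn (cr (y - x) (z - x))"
  define u where "u = y - x"
  have "0 < s * cr (y - x) (z - x)" using c(1) by (auto simp: corner_at_def s_def sgn_if)
  then have S: "side_at s x u 0 1 z T" unfolding u_def by (rule corner_at_side[OF c(1)])
  have al: "0 * (u \<bullet> u) < (z - x) \<bullet> u" using side_at_acute_left[OF S] c(2) by (simp add: u_def)
  have ar: "(z - x) \<bullet> u < 1 * (u \<bullet> u)" using side_at_acute_right[OF S] c(3) by (simp add: u_def)
  obtain a b r N where N: "side_at (- s) x u a b r N" "a \<le> 0" "0 < b"
    by (rule across_forward[OF S, of 0]) auto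
  show False
  proof (cases "b < 1")
    case True
    obtain a2 b2 r2 N2 where N2: "side_at (- s) x u a2 b2 r2 N2" "a2 \<le> b" "b < b2"
      by (rule across_forward[OF S, of b]) (use True N in auto)
    have "a2 = b"
    proof (rule ccontr)
      assume "a2 \<noteq> b"
      moreover have "a < b" using N by simp
      ultimately have "max a a2 < min b b2" using N2 by auto
      then show False using side_at_overlap(3)[OF N(1) N2(1)] N2 by simp
    qed
    then have N2': "side_at (- s) x u b b2 r2 N2" using N2 by simp
    have S': "side_at (- (- s)) x u 0 1 z T" using S by simp
    \<comment> \<open>At their common end \<open>b\<close> at most one of \<open>N\<close> and
      \<open>N2\<close> is acute. The other one takes the role of the base triangle, and
      \<open>T\<close>, lying across it over \<open>b\<close>, would lose one of its acute
      ends.\<close>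
    consider "\<not> (r - x) \<bullet> u < b * (u \<bullet> u)" | "\<not> b * (u \<bullet> u) < (r2 - x) \<bullet> u"
      using side_at_one_acute[OF N(1) _ N2'] by blast
    then show False
    proof cases
      case 1
      then show False using non_acute_right[OF N(1) 1 S'] al N True by simp
    next
      case 2
      then show False using non_acute_left[OF N2' 2 S'] ar N True by simp
    qed
  next
    case False
    then have "\<not> (r - x) \<bullet> u < b * (u \<bullet> u)" using across_acute_right[OF S ar N(1)] N by simp
    moreover have "\<not> a * (u \<bullet> u) < (r - x) \<bullet> u" using across_acute_left[OF S al N] .
    ultimately show False using side_at_acute_cases[OF N(1)] by blast
  qed
qed

end

section \<open>Arcs of unit circles\<close>

definition dir :: "real \<Rightarrow> real ^ 2" where
  "dir \<theta> = vector [cos \<theta>, sin \<theta>]"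

lemma dir_nth [simp]: "dir \<theta> $ 1 = cos \<theta>" "dir \<theta> $ 2 = sin \<theta>"
  by (simp_all add: dir_def)

lemma inner_real2: "x \<bullet> y = x $ 1 * y $ 1 + x $ 2 * y $ 2" for x y :: "real ^ 2"
  by (simp add: inner_vec_def sum_2)

lemma inner_dir: "dir a \<bullet> dir b = cos (a - b)"
  by (simp add: inner_real2 cos_diff)

lemma norm_dir [simp]: "norm (dir a) = 1"
  using inner_dir[of a a] by (simp add: norm_eq_sqrt_inner)

lemma dir_pi: "dir (a + pi) = - dir a"
  by (simp add: vec_eq_iff forall_2)

text \<open>Two unit vectors 120 degrees apart span a rhombus made of two equilateral triangles, so
  their sum is the unit vector between them. This identifies the centres of the disks in
  \<open>degree_le_three\<close>.\<close>

lemma dir_third: "dir (a - pi / 3) = dir a + dir (a - 2 * pi / 3)"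
proof -
  have "2 * pi / 3 = pi - pi / 3" by simp
  then have "cos (2 * pi / 3) = - (1 / 2)" "sin (2 * pi / 3) = sqrt 3 / 2"
    by (simp_all only: cos_diff sin_diff cos_60 sin_60) simp_all
  then show ?thesis
    by (simp add: vec_eq_iff forall_2 cos_diff sin_diff cos_60 sin_60 algebra_simps)
qed

lemma dist_dir: "(dist (w + dir a) (w + dir b))\<^sup>2 = 2 - 2 * cos (a - b)"
proof -
  have "(dist (w + dir a) (w + dir b))\<^sup>2 = (dir a - dir b) \<bullet> (dir a - dir b)"
    by (simp add: dist_norm power2_norm_eq_inner)
  also have "\<dots> = 2 - 2 * cos (a - b)"
    by (simp add: inner_diff_left inner_diff_right inner_dir cos_diff algebra_simps)
  finally show ?thesis .
qed

lemma dist_dir_third: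
  assumes "\<bar>a - b\<bar> = pi / 3"
  shows "dist (w + dir a) (w + dir b) = 1"
proof -
  have "cos (a - b) = 1 / 2" using assms cos_60 by (metis cos_abs_real)
  then have "(dist (w + dir a) (w + dir b))\<^sup>2 = 1\<^sup>2" unfolding dist_dir by simp
  then show ?thesis by (rule power2_eq_imp_eq) simp_all
qed

lemma dist_dir_less:
  assumes "\<bar>a - b\<bar> < pi / 3"
  shows "dist (w + dir a) (w + dir b) < 1"
proof -
  have "1 / 2 < cos \<bar>a - b\<bar>"
    using cos_monotone_0_pi[of "\<bar>a - b\<bar>" "pi / 3"] assms cos_60 by simp
  then have "(dist (w + dir a) (w + dir b))\<^sup>2 < 1\<^sup>2" unfolding dist_dir by simp
  then show ?thesis by (rule power2_less_imp_less) simp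
qed

lemma dist_dir_greater:
  assumes "pi / 3 < \<bar>a - b\<bar>" "\<bar>a - b\<bar> \<le> pi"
  shows "1 < dist (w + dir a) (w + dir b)"
proof -
  have "cos \<bar>a - b\<bar> < 1 / 2"
    using cos_monotone_0_pi[of "pi / 3" "\<bar>a - b\<bar>"] assms cos_60 by simp
  then have "1\<^sup>2 < (dist (w + dir a) (w + dir b))\<^sup>2" unfolding dist_dir by simp
  then show ?thesis by (rule power2_less_imp_less) simp
qed

lemma inner_expand:
  "n \<bullet> y = (n \<bullet> dir \<theta>) * (y \<bullet> dir \<theta>) + (n \<bullet> dir (\<theta> + pi / 2)) * (y \<bullet> dir (\<theta> + pi / 2))"
proof -
  have *: "(n $ 1 * c + n $ 2 * s) * (y $ 1 * c + y $ 2 * s) + (n $ 2 * c - n $ 1 * s) * (y $ 2 * c - y $ 1 * s) =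
      (n \<bullet> y) * (s\<^sup>2 + c\<^sup>2)" for c s
    by (simp add: inner_real2 power2_eq_square algebra_simps)
  show ?thesis using *[of "cos \<theta>" "sin \<theta>"] by (simp add: inner_real2 cos_add sin_add)
qed

lemma inner_dir_add: "n \<bullet> dir (\<theta> + t) = (n \<bullet> dir \<theta>) * cos t + (n \<bullet> dir (\<theta> + pi / 2)) * sin t"
  by (simp add: inner_real2 cos_add sin_add algebra_simps)

lemma tendsto_dir [tendsto_intros]:
  fixes f :: "'a::t2_space \<Rightarrow> real"
  shows "(f \<longlongrightarrow> a) F \<Longrightarrow> ((\<lambda>x. dir (f x)) \<longlongrightarrow> dir a) F"
proof (rule vec_tendstoI)
  fix i :: 2
  assume "(f \<longlongrightarrow> a) F"
  then show "((\<lambda>x. dir (f x) $ i) \<longlongrightarrow> dir a $ i) F"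
    using tendsto_cos[of f a F] tendsto_sin[of f a F] exhaust_2[of i] by auto
qed

text \<open>If the value at zero does not vanish, continuity decides; otherwise the derivative at
  zero decides. If that vanishes too, what remains is \<open>A * (cos (s * t) - 1)\<close>, whose
  sign is opposite to that of \<open>A\<close>.\<close>

lemma trig_eventually_sign:
  fixes A B c s :: real
  assumes "A \<noteq> 0 \<or> B \<noteq> 0" "s \<noteq> 0"
  shows "(\<forall>\<^sub>F t in at_right 0. 0 < c + A * cos (s * t) + B * sin (s * t)) \<or>
         (\<forall>\<^sub>F t in at_right 0. c + A * cos (s * t) + B * sin (s * t) < 0)"
proof -
  let ?f = "\<lambda>t. c + A * cos (s * t) + B * sin (s * t)"
  consider "c + A \<noteq> 0" | "c = - A" "B \<noteq> 0" | "c = - A" "B = 0" "A \<noteq> 0" using assms(1) by fastforce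
  then show ?thesis
  proof cases
    case 1
    have "(?f \<longlongrightarrow> c + A * cos (s * 0) + B * sin (s * 0)) (at_right 0)" by (intro tendsto_intros)
    then show ?thesis using 1 order_tendstoD[of ?f "c + A" "at_right 0" 0] by (cases "0 < c + A") auto
  next
    case 2
    have D: "(?f has_real_derivative B * s) (at 0)"
      by (auto intro!: derivative_eq_intros)
    show ?thesis
    proof (cases "0 < B * s")
      case True
      then obtain d where d: "0 < d" "\<And>h. \<lbrakk>0 < h; h < d\<rbrakk> \<Longrightarrow> ?f 0 < ?f (0 + h)"
        using DERIV_pos_inc_right[OF D True] by blast
      then have "\<forall>\<^sub>F t in at_right 0. 0 < ?f t"
        using 2 by (intro eventually_at_rightI[of 0 d]) auto
      then show ?thesis ..
    next
      case False
      then have neg: "B * s < 0" using 2 assms(2) by (simp add: not_less less_le)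
      then obtain d where d: "0 < d" "\<And>h. \<lbrakk>0 < h; h < d\<rbrakk> \<Longrightarrow> ?f 0 > ?f (0 + h)"
        using DERIV_neg_dec_right[OF D neg] by blast
      then have "\<forall>\<^sub>F t in at_right 0. ?f t < 0"
        using 2 by (intro eventually_at_rightI[of 0 d]) auto
      then show ?thesis ..
    qed
  next
    case 3
    have "\<forall>\<^sub>F t in at_right 0. cos (s * t) < 1"
    proof (rule eventually_at_rightI[of 0 "pi / \<bar>s\<bar>"])
      fix t assume "t \<in> {0<..<pi / \<bar>s\<bar>}"
      then have "0 < \<bar>s * t\<bar>" "\<bar>s * t\<bar> \<le> pi" using assms(2) by (auto simp: abs_mult field_simps)
      then have "cos \<bar>s * t\<bar> < cos 0" by (intro cos_monotone_0_pi) auto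
      then show "cos (s * t) < 1" by simp
    qed (use assms(2) in auto)
    then have "\<forall>\<^sub>F t in at_right 0. if 0 < A then A * (cos (s * t) - 1) < 0 else 0 < A * (cos (s * t) - 1)"
      by eventually_elim (use 3(3) in \<open>simp add: mult_pos_neg mult_neg_neg\<close>)
    then show ?thesis using 3 by (cases "0 < A") (simp_all add: algebra_simps)
  qed
qed

lemma affine_eventually_sign:
  fixes n w x :: "real ^ 2"
  assumes "n \<noteq> 0" "s \<noteq> 0"
  shows "(\<forall>\<^sub>F t in at_right 0. 0 < c + n \<bullet> (w + dir (\<theta> + s * t) - x)) \<or>
         (\<forall>\<^sub>F t in at_right 0. c + n \<bullet> (w + dir (\<theta> + s * t) - x) < 0)"
proof -
  have nz: "n \<bullet> dir \<theta> \<noteq> 0 \<or> n \<bullet> dir (\<theta> + pi / 2) \<noteq> 0"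
  proof (rule ccontr)
    assume "\<not> ?thesis"
    then have "n \<bullet> n = 0" unfolding inner_expand[of n n \<theta>] by simp
    then show False using assms(1) by simp
  qed
  have "c + n \<bullet> (w + dir (\<theta> + s * t) - x) =
     (c + n \<bullet> (w - x)) + (n \<bullet> dir \<theta>) * cos (s * t) + (n \<bullet> dir (\<theta> + pi / 2)) * sin (s * t)" for t
    by (simp add: inner_dir_add[of n \<theta> "s * t"] inner_diff_right inner_add_right)
  then show ?thesis using trig_eventually_sign[OF nz assms(2)] by (simp only:)
qed

section \<open>Triangles entered by arcs of unit circles\<close>

context triangle_tiling
begin

text \<open>The germ of the circle at angle \<open>\<theta>\<close>, counterclockwise for
  \<open>s = 1\<close> and clockwise for \<open>s = - 1\<close>. Germs avoid the borders and
  vertices, whose colors carry no information.\<close>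

definition arc :: "real \<Rightarrow> real ^ 2 \<Rightarrow> real \<Rightarrow> (real ^ 2) set \<Rightarrow> bool" where
  "arc s w \<theta> P \<longleftrightarrow> (\<forall>\<^sub>F t in at_right 0. w + dir (\<theta> + s * t) \<in> P)"

text \<open>A triangle is cut out by three affine inequalities. On a circle each affine form is a
  nonconstant trigonometric polynomial, hence of strict constant sign on a short arc.\<close>

lemma arc_or_outside:
  assumes "P \<in> R" "s \<noteq> 0"
  shows "arc s w \<theta> P \<or> (\<forall>\<^sub>F t in at_right 0. w + dir (\<theta> + s * t) \<notin> closure P)"
proof -
  obtain x y z where P: "P = tri x y z" "cr (y - x) (z - x) \<noteq> 0" using assms(1) by (rule region_tri)
  let ?D = "cr (y - x) (z - x)"
  define J :: "real ^ 2 \<Rightarrow> real ^ 2" where "J a = vector [- (a $ 2), a $ 1]" for a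
  have J: "J a \<bullet> b = cr a b" for a b by (simp add: J_def cr_def inner_real2)
  \<comment> \<open>At \<open>v - x\<close> the forms \<open>n1\<close> and \<open>n2\<close> give
    the barycentric weights of \<open>v\<close> at \<open>z\<close> and \<open>y\<close>, and
    \<open>n3\<close> gives the weight at \<open>x\<close> minus one.\<close>
  define n1 n2 n3 where "n1 = (1 / ?D) *\<^sub>R J (y - x)" and "n2 = - (1 / ?D) *\<^sub>R J (z - x)" and "n3 = - (n1 + n2)"
  have n: "n1 \<bullet> v = cr (y - x) v / ?D" "n2 \<bullet> v = cr v (z - x) / ?D" for v
    using cr_commute[of v "z - x"] by (simp_all add: n1_def n2_def J)
  have "n1 \<bullet> (z - x) = 1" "n2 \<bullet> (y - x) = 1" "n3 \<bullet> (y - x) = - 1"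
    using P(2) by (simp_all add: n n3_def inner_add_left inner_diff_left del: inner_diff_right)
  then have nz: "n1 \<noteq> 0" "n2 \<noteq> 0" "n3 \<noteq> 0" by auto
  have v: "v = x + (n2 \<bullet> (v - x)) *\<^sub>R (y - x) + (n1 \<bullet> (v - x)) *\<^sub>R (z - x)" for v
    using cramer[OF P(2), of "v - x"] unfolding n by (simp add: algebra_simps)
  have P': "P = tri (x + 0 *\<^sub>R (y - x)) (x + 1 *\<^sub>R (y - x)) z" using P(1) by simp
  have mem: "v \<in> P \<longleftrightarrow> 0 < 0 + n1 \<bullet> (v - x) \<and> 0 < 0 + n2 \<bullet> (v - x) \<and> 0 < 1 + n3 \<bullet> (v - x)" for v
    using mem_frame_tri(1)[of 0 1 "y - x" z x "n2 \<bullet> (v - x)" "n1 \<bullet> (v - x)", folded P'] P(2)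
    unfolding v[symmetric] by (auto simp: n3_def inner_add_left inner_diff_left)
  have mem': "v \<in> closure P \<longleftrightarrow> 0 \<le> 0 + n1 \<bullet> (v - x) \<and> 0 \<le> 0 + n2 \<bullet> (v - x) \<and> 0 \<le> 1 + n3 \<bullet> (v - x)" for v
    using mem_frame_tri(2)[of 0 1 "y - x" z x "n2 \<bullet> (v - x)" "n1 \<bullet> (v - x)", folded P'] P(2)
    unfolding v[symmetric] by (auto simp: n3_def inner_add_left inner_diff_left)
  have out: "\<forall>\<^sub>F t in at_right 0. w + dir (\<theta> + s * t) \<notin> closure P"
    if "\<forall>\<^sub>F t in at_right 0. f t < 0" "\<And>t. w + dir (\<theta> + s * t) \<in> closure P \<Longrightarrow> 0 \<le> f t" for f :: "real \<Rightarrow> real"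
    using that(1) by eventually_elim (use that(2) in force)
  from affine_eventually_sign[OF nz(1) assms(2), of 0 w \<theta> x]
    affine_eventually_sign[OF nz(2) assms(2), of 0 w \<theta> x]
    affine_eventually_sign[OF nz(3) assms(2), of 1 w \<theta> x]
  show ?thesis
  proof (elim disjE)
    assume "\<forall>\<^sub>F t in at_right 0. 0 < 0 + n1 \<bullet> (w + dir (\<theta> + s * t) - x)"
      "\<forall>\<^sub>F t in at_right 0. 0 < 0 + n2 \<bullet> (w + dir (\<theta> + s * t) - x)"
      "\<forall>\<^sub>F t in at_right 0. 0 < 1 + n3 \<bullet> (w + dir (\<theta> + s * t) - x)"
    then have "arc s w \<theta> P" unfolding arc_def mem by (simp only: eventually_conj_iff)
    then show ?thesis ..
  qed (rule disjI2, erule out, simp only: mem')+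
qed

lemma arc_exists:
  assumes "s \<noteq> 0"
  obtains P where "P \<in> R" "arc s w \<theta> P"
proof -
  let ?F = "{P \<in> R. closure P \<inter> cball w 1 \<noteq> {}}"
  have "\<exists>P\<in>?F. arc s w \<theta> P"
  proof (rule ccontr)
    assume "\<not> ?thesis"
    then have "\<forall>P\<in>?F. \<forall>\<^sub>F t in at_right 0. w + dir (\<theta> + s * t) \<notin> closure P"
      using arc_or_outside[OF _ assms] by blast
    then have "\<forall>\<^sub>F t in at_right 0. \<forall>P\<in>?F. w + dir (\<theta> + s * t) \<notin> closure P"
      using finite_near by (simp only: eventually_ball_finite)
    then have "\<forall>\<^sub>F t in at_right (0::real). False"
    proof eventually_elim
      case (elim t)
      obtain P where "P \<in> R" "w + dir (\<theta> + s * t) \<in> closure P" using cover by blast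
      moreover have "w + dir (\<theta> + s * t) \<in> cball w 1" by (simp add: dist_norm)
      ultimately show ?case using elim by blast
    qed
    then show False by simp
  qed
  then show thesis using that by blast
qed

lemma arc_limit:
  assumes "arc s w \<theta> P"
  shows "w + dir \<theta> \<in> closure P"
proof -
  have "((\<lambda>t. w + dir (\<theta> + s * t)) \<longlongrightarrow> w + dir (\<theta> + s * 0)) (at_right 0)" by (intro tendsto_intros)
  moreover have "\<forall>\<^sub>F t in at_right 0. w + dir (\<theta> + s * t) \<in> closure P"
    using assms unfolding arc_def by eventually_elim (use closure_subset in blast)
  ultimately show ?thesis
    using Lim_in_closed_set[of "closure P" "\<lambda>t. w + dir (\<theta> + s * t)" "at_right 0" "w + dir (\<theta> + s * 0)"]
    by simp
qed

text \<open>A common parameter for both arcs controls the angle between the two points, so that they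
  can be placed exactly 60 degrees apart.\<close>

lemma arc_point:
  assumes "arc s w \<theta> P" "arc s' w' \<theta>' P'" "0 < \<epsilon>"
  obtains t where "0 < t" "t < \<epsilon>" "w + dir (\<theta> + s * t) \<in> P" "w' + dir (\<theta>' + s' * t) \<in> P'"
proof -
  have "\<forall>\<^sub>F t in at_right 0. 0 < t \<and> t < \<epsilon> \<and> w + dir (\<theta> + s * t) \<in> P \<and> w' + dir (\<theta>' + s' * t) \<in> P'"
    using assms(1,2) unfolding arc_def
    by (intro eventually_conj eventually_at_right_less) (use assms(3) in \<open>auto intro: eventually_at_rightI[of 0 \<epsilon>]\<close>)
  then show thesis using that by (auto dest!: eventually_happens)
qed

lemma arc_unique:
  assumes "arc s w \<theta> P" "arc s w \<theta> Q" "P \<in> R" "Q \<in> R"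
  shows "P = Q"
  using arc_point[OF assms(1,2), of 1] disjoint[OF assms(3,4)] by (metis IntI empty_iff zero_less_one)

lemma separated:
  assumes "P \<in> R" "Q \<in> R" "P \<noteq> Q" "w \<in> closure P" "w \<in> closure Q"
  obtains n where "n \<noteq> 0" "\<And>x. x \<in> closure P \<Longrightarrow> n \<bullet> (x - w) \<le> 0" "\<And>x. x \<in> closure Q \<Longrightarrow> 0 \<le> n \<bullet> (x - w)"
proof -
  obtain a b where ab: "a \<noteq> 0" "\<forall>x\<in>P. a \<bullet> x \<le> b" "\<forall>x\<in>Q. b \<le> a \<bullet> x"
    using separating_hyperplane_sets[OF region_convex[OF assms(1)] region_convex[OF assms(2)]]
      region_nonempty assms disjoint by blast
  have "closure P \<subseteq> {x. a \<bullet> x \<le> b}" "closure Q \<subseteq> {x. b \<le> a \<bullet> x}"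
    using ab by (intro closure_minimal closed_Collect_le continuous_intros; blast)+
  then have c: "\<And>x. x \<in> closure P \<Longrightarrow> a \<bullet> x \<le> b" "\<And>x. x \<in> closure Q \<Longrightarrow> b \<le> a \<bullet> x" by auto
  then have "a \<bullet> w = b" using assms(4,5) by (simp add: order_antisym)
  then show thesis using that[OF ab(1)] c by (simp add: inner_diff_right)
qed

end

section \<open>Tilings colored with six colors\<close>

locale colored_tiling = triangle_tiling R for R +
  fixes color :: "(real ^ 2) set \<Rightarrow> 'c"
  assumes touching: "\<lbrakk>P \<in> R; Q \<in> R; P \<noteq> Q; x \<in> closure P; x \<in> closure Q\<rbrakk> \<Longrightarrow> color P \<noteq> color Q"
    and unit_distance: "\<lbrakk>P \<in> R; Q \<in> R; x \<in> P; y \<in> Q; dist x y = 1\<rbrakk> \<Longrightarrow> color P \<noteq> color Q"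
    and finite_colors: "finite (color ` R)"
    and few_colors: "card (color ` R) \<le> 6"
begin

lemma inj_on_color: "inj_on color (regions_at p)"
  by (rule inj_onI) (metis regions_at_iff touching)

text \<open>If \<open>w\<close> is only in the closure of a triangle, it is replaced by a nearby
  point \<open>q\<close> of that triangle. Shifting \<open>y\<close> by \<open>q - w\<close>
  preserves the distance and stays in the open set \<open>P\<close>.\<close>

lemma color_of_circle:
  assumes "P \<in> R" "y \<in> P" "dist y w = 1"
  shows "color P \<notin> color ` regions_at w"
proof
  assume "color P \<in> color ` regions_at w"
  then obtain Q where Q: "Q \<in> R" "w \<in> closure Q" "color Q = color P" by (auto simp: regions_at_iff)
  obtain \<epsilon> where e: "0 < \<epsilon>" "ball y \<epsilon> \<subseteq> P"
    using region_open[OF assms(1)] assms(2) open_contains_ball by blast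
  obtain q where q: "q \<in> Q" "dist q w < \<epsilon>" using Q(2) e(1) closure_approachable by blast
  have "dist y (y + (q - w)) < \<epsilon>" using q(2) by (simp add: dist_norm norm_minus_commute)
  then have "y + (q - w) \<in> P" using e(2) by auto
  moreover have "dist (y + (q - w)) q = 1" using assms(3) by (simp add: dist_norm algebra_simps)
  ultimately show False using unit_distance assms(1) Q q by metis
qed

lemma arc_color:
  assumes "P \<in> R" "arc s w \<theta> P"
  shows "color P \<notin> color ` regions_at w"
proof -
  obtain t where "w + dir (\<theta> + s * t) \<in> P"
    by (rule arc_point[OF assms(2) assms(2) zero_less_one])
  then show ?thesis by (intro color_of_circle[OF assms(1)]) (auto simp: dist_norm)
qed

text \<open>The distances between points of two connected sets form an interval, and
  \<open>unit_distance\<close> keeps one out of it. Closures inherit the weak inequalities.\<close>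

lemma same_color_distances:
  assumes "P \<in> R" "Q \<in> R" "color P = color Q"
  shows "(\<forall>x\<in>closure P. \<forall>y\<in>closure Q. dist x y \<le> 1) \<or> (\<forall>x\<in>closure P. \<forall>y\<in>closure Q. 1 \<le> dist x y)"
proof -
  let ?f = "\<lambda>p :: (real ^ 2) \<times> (real ^ 2). dist (fst p) (snd p)"
  have "connected (?f ` (P \<times> Q))"
    using region_convex assms
    by (intro connected_continuous_image connected_Times convex_connected continuous_intros) auto
  moreover have "1 \<notin> ?f ` (P \<times> Q)"
  proof
    assume "1 \<in> ?f ` (P \<times> Q)"
    then obtain x y where "x \<in> P" "y \<in> Q" "dist x y = 1" by auto
    then show False using unit_distance assms by blast
  qed
  ultimately have "(\<forall>d\<in>?f ` (P \<times> Q). d \<le> 1) \<or> (\<forall>d\<in>?f ` (P \<times> Q). 1 \<le> d)"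
    by (meson connectedD_interval linear)
  then have "P \<times> Q \<subseteq> {p. ?f p \<le> 1} \<or> P \<times> Q \<subseteq> {p. 1 \<le> ?f p}" by auto
  moreover have "closed {p. ?f p \<le> 1}" "closed {p. 1 \<le> ?f p}"
    by (intro closed_Collect_le continuous_intros)+
  ultimately have "closure (P \<times> Q) \<subseteq> {p. ?f p \<le> 1} \<or> closure (P \<times> Q) \<subseteq> {p. 1 \<le> ?f p}"
    using closure_minimal by blast
  then show ?thesis unfolding closure_Times by auto
qed

lemma region_in_ball:
  assumes "P \<in> R" "color P \<in> color ` regions_at w" "x \<in> P" "dist x w < 1"
  shows "P \<subseteq> ball w 1"
proof
  fix y assume y: "y \<in> P"
  have "connected ((\<lambda>x. dist x w) ` P)"
    using region_convex[OF assms(1)] by (intro connected_continuous_image convex_connected continuous_intros) auto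
  moreover have "1 \<notin> (\<lambda>x. dist x w) ` P"
  proof
    assume "1 \<in> (\<lambda>x. dist x w) ` P"
    then obtain z where "z \<in> P" "dist z w = 1" by auto
    then show False using color_of_circle assms(1,2) by blast
  qed
  ultimately have "\<not> 1 \<le> dist y w"
    using connectedD_interval[of "(\<lambda>x. dist x w) ` P" "dist x w" "dist y w" 1] assms(3,4) y by auto
  then show "y \<in> ball w 1" by (simp add: dist_commute)
qed

section \<open>Points at which four triangles meet\<close>

lemma
  assumes P: "P1 \<in> R" "P2 \<in> R" "color P1 \<noteq> color P2"
    "color P1 \<notin> color ` regions_at v" "color P2 \<notin> color ` regions_at v"
  shows two_colors_on_circle:
      "4 \<le> card (regions_at v) \<Longrightarrow> color ` R = color ` regions_at v \<union> {color P1, color P2}"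
    and degree_le_four: "card (regions_at v) \<le> 4"
proof -
  let ?C = "color ` regions_at v"
  \<comment> \<open>The triangles at \<open>v\<close> have pairwise different colors and the two
    given colors are new, so six colors leave room for at most four triangles, and four use up all
    colors.\<close>
  have "card (?C \<union> {color P1, color P2}) = card ?C + card {color P1, color P2}"
    using P finite_regions_at by (intro card_Un_disjoint) auto
  also have "card ?C = card (regions_at v)" by (rule card_image[OF inj_on_color])
  finally have card: "card (?C \<union> {color P1, color P2}) = card (regions_at v) + 2" using P(3) by simp
  have sub: "?C \<union> {color P1, color P2} \<subseteq> color ` R" using P by (auto simp: regions_at_iff)
  show "card (regions_at v) \<le> 4"
    using card_mono[OF finite_colors sub] card few_colors by simp
  show "color ` R = ?C \<union> {color P1, color P2}" if "4 \<le> card (regions_at v)"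
    using card_seteq[OF finite_colors sub] card few_colors that by simp
qed

text \<open>Only the colors of \<open>P\<close> and \<open>P'\<close> are available on the circle,
  and rotation by 60 degrees moves its points by distance one, so it exchanges the two colors. This
  produces the next switch; the repeated colors confine \<open>P\<close> to a disk and
  \<open>P'\<close> to a half plane.\<close>

lemma switch_step:
  assumes four: "4 \<le> card (regions_at v)" and s: "\<bar>s\<bar> = 1"
    and P: "P \<in> R" "arc s v \<theta> P" and P': "P' \<in> R" "arc (- s) v \<theta> P'" and "P \<noteq> P'"
  shows "P \<subseteq> ball (v + dir (\<theta> + s * pi / 3)) 1"
    and "x \<in> closure P' \<Longrightarrow> (x - (v + dir \<theta>)) \<bullet> (dir (\<theta> + s * pi / 3) - dir \<theta>) \<le> 0"
    and "\<exists>Q\<in>R. \<exists>Q'\<in>R. arc s v (\<theta> + s * pi / 3) Q \<and> arc (- s) v (\<theta> + s * pi / 3) Q' \<and> Q \<noteq> Q'"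
proof -
  define \<theta>' where "\<theta>' = \<theta> + s * pi / 3"
  have s0: "s \<noteq> 0" "- s \<noteq> 0" using s by auto
  have st: "\<bar>s * t\<bar> = \<bar>t\<bar>" for t using s by (simp add: abs_mult)
  have pi3: "0 < pi / 3" by simp
  have neq: "color P \<noteq> color P'"
    using touching[OF P(1) P'(1) \<open>P \<noteq> P'\<close> arc_limit[OF P(2)] arc_limit[OF P'(2)]] .
  obtain Q where Q: "Q \<in> R" "arc s v \<theta>' Q" by (rule arc_exists[OF s0(1)])
  obtain Q' where Q': "Q' \<in> R" "arc (- s) v \<theta>' Q'" by (rule arc_exists[OF s0(2)])
  note two = two_colors_on_circle[OF P(1) P'(1) neq arc_color[OF P] arc_color[OF P'] four]
  have col: "color S \<in> {color P, color P'}" if "S \<in> R" "arc r v a S" for r a S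
    using arc_color[OF that] two that(1) by blast
  have third: "\<bar>(\<theta> + r) - (\<theta>' + r)\<bar> = pi / 3" for r using st[of "pi / 3"] by (simp add: \<theta>'_def)
  have "color Q \<noteq> color P"
  proof -
    obtain t where "v + dir (\<theta> + s * t) \<in> P" "v + dir (\<theta>' + s * t) \<in> Q"
      by (rule arc_point[OF P(2) Q(2) zero_less_one])
    then show ?thesis using unit_distance[OF P(1) Q(1) _ _ dist_dir_third[OF third]] by metis
  qed
  then have cQ: "color Q = color P'" using col[OF Q] by blast
  have "color Q' \<noteq> color P'"
  proof -
    obtain t where "v + dir (\<theta> + - s * t) \<in> P'" "v + dir (\<theta>' + - s * t) \<in> Q'"
      by (rule arc_point[OF P'(2) Q'(2) zero_less_one])
    then show ?thesis using unit_distance[OF P'(1) Q'(1) _ _ dist_dir_third[OF third]] by metis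
  qed
  then have cQ': "color Q' = color P" using col[OF Q'] by blast
  have "Q \<noteq> Q'" using cQ cQ' neq by auto
  then show "\<exists>Q\<in>R. \<exists>Q'\<in>R. arc s v (\<theta> + s * pi / 3) Q \<and> arc (- s) v (\<theta> + s * pi / 3) Q' \<and> Q \<noteq> Q'"
    using Q Q' unfolding \<theta>'_def by blast
  let ?w = "v + dir \<theta>" and ?w' = "v + dir \<theta>'"
  \<comment> \<open>The color of \<open>P\<close> occurs at \<open>?w'\<close>, and \<open>P\<close>
    has a point less than 60 degrees from \<open>?w'\<close>, so it stays in the unit disk around
    \<open>?w'\<close>.\<close>
  have "Q' \<in> regions_at ?w'" using Q' arc_limit by (simp add: regions_at_iff)
  then have cP: "color P \<in> color ` regions_at ?w'" using cQ' by (metis imageI)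
  obtain t where t: "0 < t" "t < pi / 3" "v + dir (\<theta> + s * t) \<in> P"
    by (rule arc_point[OF P(2) P(2) pi3])
  have "\<bar>(\<theta> + s * t) - \<theta>'\<bar> < pi / 3"
    using s t(1,2) by (auto simp: \<theta>'_def abs_if split: if_splits)
  then show "P \<subseteq> ball (v + dir (\<theta> + s * pi / 3)) 1"
    using region_in_ball[OF P(1) cP t(3)] dist_dir_less unfolding \<theta>'_def by blast
  \<comment> \<open>Moving backwards in \<open>P'\<close> and forwards in \<open>Q\<close> opens the
    angle beyond 60 degrees. One distance exceeds one, hence all distances between these triangles
    of one color are at least one.\<close>
  obtain t where t: "0 < t" "t < pi / 3" "v + dir (\<theta> + - s * t) \<in> P'" "v + dir (\<theta>' + s * t) \<in> Q"
    by (rule arc_point[OF P'(2) Q(2) pi3])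
  have "pi / 3 < \<bar>(\<theta> + - s * t) - (\<theta>' + s * t)\<bar>" "\<bar>(\<theta> + - s * t) - (\<theta>' + s * t)\<bar> \<le> pi"
    using s t(1,2) by (auto simp: \<theta>'_def abs_if split: if_splits)
  then have "1 < dist (v + dir (\<theta> + - s * t)) (v + dir (\<theta>' + s * t))" by (rule dist_dir_greater)
  then have far: "1 \<le> dist x y" if "x \<in> closure P'" "y \<in> closure Q" for x y
    using same_color_distances[OF P'(1) Q(1) cQ[symmetric]] that t(3,4) closure_subset
    by (meson in_mono not_less)
  show "(x - ?w) \<bullet> (dir (\<theta> + s * pi / 3) - dir \<theta>) \<le> 0" if x: "x \<in> closure P'" for x
  proof -
    \<comment> \<open>So \<open>?w\<close> is a point of the convex closure of \<open>P'\<close>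
      nearest to \<open>?w'\<close>, which yields the half plane.\<close>
    have "dist ?w' ?w = 1" using third[of 0] by (intro dist_dir_third) (simp add: abs_minus_commute)
    moreover have "?w \<in> closure P'" "?w' \<in> closure Q" using arc_limit P'(2) Q(2) by blast+
    ultimately have "(?w' - ?w) \<bullet> (x - ?w) \<le> 0"
      using far x region_convex[OF P'(1)]
      by (intro any_closest_point_dot[of "closure P'"]) (auto simp: dist_commute convex_closure)
    then show ?thesis by (simp add: \<theta>'_def inner_commute)
  qed
qed

text \<open>Separating \<open>G\<close> from either arc by a line through the switch point forces both lines to be radial,
  so \<open>G\<close> would lie on that radial line.\<close>

lemma not_through_switch:
  assumes P: "P \<in> R" "arc 1 v \<theta> P" and P': "P' \<in> R" "arc (- 1) v \<theta> P'"
    and G: "G \<in> R" "G \<noteq> P" "G \<noteq> P'" "v + dir \<theta> \<in> closure G" and t: "0 < t" "0 < t'"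
    "v + dir \<theta> + t *\<^sub>R dir \<theta> \<in> closure G" "v + dir \<theta> + t' *\<^sub>R (- dir \<theta>) \<in> closure G"
  shows False
proof -
  let ?w = "v + dir \<theta>" and ?f = "dir (\<theta> + pi / 2)"
  have side: "0 \<le> - s * (?f \<bullet> (x - ?w))"
    if s: "\<bar>s\<bar> = 1" and S: "S \<in> R" "arc s v \<theta> S" "G \<noteq> S" and x: "x \<in> closure G" for s S x
  proof -
    obtain n where n: "n \<noteq> 0" "\<And>x. x \<in> closure G \<Longrightarrow> n \<bullet> (x - ?w) \<le> 0" "\<And>x. x \<in> closure S \<Longrightarrow> 0 \<le> n \<bullet> (x - ?w)"
      by (rule separated[OF G(1) S(1) S(3) G(4) arc_limit[OF S(2)]]) blast
    have "t * (n \<bullet> dir \<theta>) \<le> 0" "t' * (n \<bullet> dir \<theta>) \<ge> 0" using n(2)[OF t(3)] n(2)[OF t(4)] by simp_all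
    then have n0: "n \<bullet> dir \<theta> = 0" using t(1,2) by (simp add: mult_le_0_iff zero_le_mult_iff)
    have expand: "n \<bullet> y = (n \<bullet> ?f) * (?f \<bullet> y)" for y
      using inner_expand[of n y \<theta>] n0 by (simp add: inner_commute)
    have "n \<bullet> ?f \<noteq> 0"
    proof
      assume "n \<bullet> ?f = 0"
      then have "n \<bullet> n = 0" using expand[of n] by simp
      then show False using n(1) by simp
    qed
    obtain r where r: "0 < r" "r < pi" "v + dir (\<theta> + s * r) \<in> S" by (rule arc_point[OF S(2) S(2) pi_gt_zero])
    have "v + dir (\<theta> + s * r) \<in> closure S" using r(3) closure_subset by blast
    then have "0 \<le> n \<bullet> (dir (\<theta> + s * r) - dir \<theta>)" using n(3) by fastforce
    then have "0 \<le> (n \<bullet> ?f) * sin (s * r)"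
      using n0 inner_dir_add[of n \<theta> "s * r"] by (simp add: inner_diff_right)
    moreover have "sin (s * r) = s * sin r" using s by (auto simp: abs_if split: if_splits)
    moreover have "0 < sin r" by (rule sin_gt_zero[OF r(1,2)])
    ultimately have "0 \<le> sin r * (s * (n \<bullet> ?f))" "0 < sin r" by (simp_all add: ac_simps)
    then have "0 \<le> s * (n \<bullet> ?f)" by (simp add: zero_le_mult_iff)
    then have pos: "0 < s * (n \<bullet> ?f)" using \<open>n \<bullet> ?f \<noteq> 0\<close> s by (auto simp: less_le)
    have "s * s = 1" using s by (metis abs_mult_self_eq mult_1)
    have "(n \<bullet> ?f) * (?f \<bullet> (x - ?w)) \<le> 0" using n(2)[OF x] unfolding expand[of "x - ?w"] .
    then have "(s * s) * ((n \<bullet> ?f) * (?f \<bullet> (x - ?w))) \<le> 0" using \<open>s * s = 1\<close> by simp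
    then have "(s * (n \<bullet> ?f)) * (s * (?f \<bullet> (x - ?w))) \<le> 0" by (simp only: ac_simps)
    then have "\<not> 0 < s * (?f \<bullet> (x - ?w))" using mult_pos_pos[OF pos, of "s * (?f \<bullet> (x - ?w))"] by linarith
    then show ?thesis by simp
  qed
  have zero: "?f \<bullet> (x - ?w) = 0" if "x \<in> G" for x
  proof -
    have c: "x \<in> closure G" using that closure_subset by blast
    have "0 \<le> - 1 * (?f \<bullet> (x - ?w))" by (rule side[OF _ P G(2) c]) simp
    moreover have "0 \<le> - (- 1) * (?f \<bullet> (x - ?w))" by (rule side[OF _ P' G(3) c]) simp
    ultimately show ?thesis by linarith
  qed
  obtain x where x: "x \<in> G" using region_nonempty[OF G(1)] by blast
  have "\<forall>\<^sub>F r in at_right 0. x + r *\<^sub>R ?f \<in> G"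
  proof (rule topological_tendstoD)
    show "((\<lambda>r. x + r *\<^sub>R ?f) \<longlongrightarrow> x + 0 *\<^sub>R ?f) (at_right 0)" by (intro tendsto_intros)
  qed (use x region_open[OF G(1)] in auto)
  then have "\<forall>\<^sub>F r in at_right (0::real). False"
    using eventually_at_right_less[of 0]
  proof eventually_elim
    case (elim r)
    have "?f \<bullet> (x + r *\<^sub>R ?f - ?w) = ?f \<bullet> (x - ?w) + r"
      by (simp add: inner_add_right inner_diff_right inner_dir)
    then show ?case using zero[OF elim(1)] zero[OF x] elim(2) by simp
  qed
  then show False by simp
qed

text \<open>By \<open>switch_step\<close>, half planes keep \<open>P\<close> and \<open>P'\<close>
  away from the direction towards \<open>v\<close>, and disks keep them away from the opposite
  direction. The triangles \<open>G\<close> and \<open>G'\<close> in these directions differ by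
  \<open>not_through_switch\<close>. The triangle \<open>X\<close> provides the hypothesis of
  \<open>arcs_distinct\<close>.\<close>

lemma switch_degree:
  assumes four: "4 \<le> card (regions_at v)"
    and P: "P \<in> R" "arc 1 v \<theta> P" and P': "P' \<in> R" "arc (- 1) v \<theta> P'" and "P \<noteq> P'"
  shows "4 \<le> card (regions_at (v + dir \<theta>))"
    and "\<exists>X\<in>R. v \<in> closure X \<and> X \<subseteq> cball (v + dir \<theta>) 1"
proof -
  let ?w = "v + dir \<theta>"
  have P'': "arc (- (- 1)) v \<theta> P" using P by simp
  note step = switch_step[OF four _ P P' \<open>P \<noteq> P'\<close>, simplified]
  note step' = switch_step[OF four _ P' P(1) P'' \<open>P \<noteq> P'\<close>[symmetric], simplified]
  have w: "?w \<in> closure P" "?w \<in> closure P'" using arc_limit P P' by blast+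
  have sixty: "dir \<theta> \<bullet> dir (\<theta> + pi / 3) = 1 / 2" "dir \<theta> \<bullet> dir (\<theta> - pi / 3) = 1 / 2"
    by (simp_all add: inner_dir cos_60)
  obtain G \<epsilon> where G: "G \<in> R" "\<epsilon> > 0" "\<And>t. \<lbrakk>0 \<le> t; t \<le> \<epsilon>\<rbrakk> \<Longrightarrow> ?w + t *\<^sub>R (- dir \<theta>) \<in> closure G"
    by (rule region_in_direction[of ?w "- dir \<theta>"]) blast
  have wG: "?w \<in> closure G" using G(3)[of 0] G(2) by simp
  have eG: "?w + \<epsilon> *\<^sub>R (- dir \<theta>) \<in> closure G" using G(2,3) by simp
  have inner: "(?w + \<epsilon> *\<^sub>R (- dir \<theta>) - ?w) \<bullet> (y - dir \<theta>) = \<epsilon> / 2" if "dir \<theta> \<bullet> y = 1 / 2" for y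
    using that by (simp add: inner_diff_right inner_dir algebra_simps)
  have "G \<noteq> P" using step'(2)[of "?w + \<epsilon> *\<^sub>R (- dir \<theta>)"] inner[OF sixty(2)] eG G(2) by auto
  have "G \<noteq> P'" using step(2)[of "?w + \<epsilon> *\<^sub>R (- dir \<theta>)"] inner[OF sixty(1)] eG G(2) by auto
  have neq: "color P \<noteq> color P'" using touching[OF P(1) P'(1) \<open>P \<noteq> P'\<close> w] .
  have "color G \<noteq> color P" "color G \<noteq> color P'"
    using touching[OF G(1) _ _ wG] P(1) P'(1) \<open>G \<noteq> P\<close> \<open>G \<noteq> P'\<close> w by metis+
  \<comment> \<open>Every color other than those of \<open>P\<close> and \<open>P'\<close> occurs at
    \<open>v\<close>, because the six colors are used up.\<close>
  then have "color G \<in> color ` regions_at v"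
    using two_colors_on_circle[OF P(1) P'(1) neq arc_color[OF P] arc_color[OF P'] four] G(1) by blast
  then obtain X where X: "X \<in> R" "v \<in> closure X" "color X = color G" by (auto simp: regions_at_iff)
  \<comment> \<open>With \<open>r\<close> at most one, the point of the closure of \<open>G\<close>
    at distance \<open>r\<close> towards \<open>v\<close> is closer than one to \<open>v\<close>.
    Hence no distance between the closures of \<open>X\<close> and \<open>G\<close> exceeds
    one.\<close>
  define r where "r = min \<epsilon> 1"
  have r: "0 < r" "r \<le> \<epsilon>" "r \<le> 1" using G(2) by (auto simp: r_def)
  have "v - (?w + r *\<^sub>R (- dir \<theta>)) = - ((1 - r) *\<^sub>R dir \<theta>)" by (simp add: algebra_simps)
  then have "dist v (?w + r *\<^sub>R (- dir \<theta>)) = 1 - r" unfolding dist_norm using r by (simp only: norm_minus_cancel norm_scaleR norm_dir) simp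
  then have "dist v (?w + r *\<^sub>R (- dir \<theta>)) < 1" using r by simp
  then have "\<forall>x\<in>closure X. \<forall>y\<in>closure G. dist x y \<le> 1"
    using same_color_distances[OF X(1) G(1) X(3)] X(2) G(3)[of r] r by (meson less_imp_le not_less)
  then have "X \<subseteq> cball ?w 1" using wG closure_subset[of X] by (auto simp: dist_commute)
  then show "\<exists>X\<in>R. v \<in> closure X \<and> X \<subseteq> cball ?w 1" using X by blast
  obtain G' \<delta> where G': "G' \<in> R" "\<delta> > 0" "\<And>t. \<lbrakk>0 \<le> t; t \<le> \<delta>\<rbrakk> \<Longrightarrow> ?w + t *\<^sub>R dir \<theta> \<in> closure G'"
    by (rule region_in_direction[of ?w "dir \<theta>"]) blast
  have wG': "?w \<in> closure G'" using G'(3)[of 0] G'(2) by simp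
  have eG': "?w + \<delta> *\<^sub>R dir \<theta> \<in> closure G'" using G'(2,3) by simp
  \<comment> \<open>Points radially beyond the circle at \<open>\<theta>\<close> are outside the
    disks that confine \<open>P\<close> and \<open>P'\<close>.\<close>
  have far: "?w + \<delta> *\<^sub>R dir \<theta> \<notin> cball (v + y) 1" if "dir \<theta> \<bullet> y = 1 / 2" "norm y = 1" for y
  proof
    assume "?w + \<delta> *\<^sub>R dir \<theta> \<in> cball (v + y) 1"
    then have "norm ((1 + \<delta>) *\<^sub>R dir \<theta> - y) \<le> 1"
      by (simp add: dist_norm norm_minus_commute algebra_simps)
    then have "(norm ((1 + \<delta>) *\<^sub>R dir \<theta> - y))\<^sup>2 \<le> 1" by (simp add: power_le_one)
    moreover have "(norm ((1 + \<delta>) *\<^sub>R dir \<theta> - y))\<^sup>2 = (1 + \<delta>) * (1 + \<delta>) - (1 + \<delta>) + 1"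
    proof -
      have "(norm ((1 + \<delta>) *\<^sub>R dir \<theta> - y))\<^sup>2 =
          (1 + \<delta>) * (1 + \<delta>) - 2 * ((1 + \<delta>) * (dir \<theta> \<bullet> y)) + y \<bullet> y"
        by (simp add: power2_norm_eq_inner inner_diff_left inner_diff_right inner_dir
            inner_commute[of y "dir \<theta>"] right_diff_distrib)
      moreover have "y \<bullet> y = 1" using that(2) by (simp add: norm_eq_1)
      ultimately show ?thesis unfolding that(1) by (simp add: field_simps)
    qed
    ultimately have "\<delta> + \<delta> * \<delta> \<le> 0" by (simp add: algebra_simps)
    moreover have "0 < \<delta> * \<delta>" using G'(2) by simp
    ultimately show False using G'(2) by linarith
  qed
  have "closure P \<subseteq> cball (v + dir (\<theta> + pi / 3)) 1" "closure P' \<subseteq> cball (v + dir (\<theta> - pi / 3)) 1"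
    by (rule closure_minimal[OF order_trans[OF _ ball_subset_cball] closed_cball], rule step step')+
  then have "G' \<noteq> P" "G' \<noteq> P'"
    using far[OF sixty(1) norm_dir] far[OF sixty(2) norm_dir] eG' by blast+
  moreover have "G' \<noteq> G"
    using not_through_switch[OF P P' G(1) \<open>G \<noteq> P\<close> \<open>G \<noteq> P'\<close> wG G'(2) G(2) _ eG] eG' by blast
  ultimately have "card {P, P', G, G'} = 4" using \<open>P \<noteq> P'\<close> \<open>G \<noteq> P\<close> \<open>G \<noteq> P'\<close> by auto
  moreover have "{P, P', G, G'} \<subseteq> regions_at ?w" using w wG wG' P P' G G' by (auto simp: regions_at_iff)
  ultimately show "4 \<le> card (regions_at ?w)" using card_mono[OF finite_regions_at] by metis
qed

text \<open>If one triangle contained both arcs, the line separating it from \<open>X\<close> would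
  be tangent to the circle at \<open>?v\<close>. Lying in the disk and beyond the tangent,
  \<open>X\<close> would reduce to the point \<open>?v\<close>.\<close>

lemma arcs_distinct:
  assumes X: "X \<in> R" "w + dir \<theta> \<in> closure X" "X \<subseteq> cball w 1"
    and N: "N \<in> R" "arc 1 w \<theta> N" and N': "N' \<in> R" "arc (- 1) w \<theta> N'"
  shows "N \<noteq> N'"
proof
  assume "N = N'"
  let ?v = "w + dir \<theta>" and ?f = "dir (\<theta> + pi / 2)"
  have "N \<noteq> X"
  proof
    assume "N = X"
    obtain t where "w + dir (\<theta> + 1 * t) \<in> N" by (rule arc_point[OF N(2) N(2) zero_less_one])
    moreover have "X \<subseteq> ball w 1" using interior_maximal[OF X(3) region_open[OF X(1)]] by simp
    ultimately show False using \<open>N = X\<close> by (auto simp: dist_norm)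
  qed
  then obtain n where n: "n \<noteq> 0" "\<And>x. x \<in> closure N \<Longrightarrow> n \<bullet> (x - ?v) \<le> 0" "\<And>x. x \<in> closure X \<Longrightarrow> 0 \<le> n \<bullet> (x - ?v)"
    by (rule separated[OF N(1) X(1) _ arc_limit[OF N(2)] X(2)]) blast
  define a b where "a = n \<bullet> dir \<theta>" and "b = n \<bullet> ?f"
  have le: "\<forall>\<^sub>F t in at_right 0. a * (cos t - 1) + b * sin (s * t) \<le> 0" if "\<bar>s\<bar> = 1" "arc s w \<theta> N" for s
    using that(2) unfolding arc_def
  proof eventually_elim
    case (elim t)
    then have "n \<bullet> (w + dir (\<theta> + s * t) - ?v) \<le> 0" using n(2) closure_subset by blast
    then have "n \<bullet> dir (\<theta> + s * t) - a \<le> 0" by (simp add: a_def inner_diff_right)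
    moreover have "cos (s * t) = cos t" using that(1) by (auto simp: abs_if split: if_splits)
    ultimately show ?case using inner_dir_add[of n \<theta> "s * t"] by (simp add: a_def b_def algebra_simps)
  qed
  have der: "((\<lambda>t. a * (cos t - 1) + b * sin (s * t)) has_real_derivative b * s) (at 0)" for s
    by (auto intro!: derivative_eq_intros)
  have nonpos: "b * s \<le> 0" if s: "\<bar>s\<bar> = 1" "arc s w \<theta> N" for s
  proof (rule ccontr)
    assume "\<not> ?thesis"
    then obtain d where d: "0 < d" "\<And>h. \<lbrakk>0 < h; h < d\<rbrakk> \<Longrightarrow> 0 < a * (cos h - 1) + b * sin (s * h)"
      using DERIV_pos_inc_right[OF der[of s]] by auto
    have "\<forall>\<^sub>F t in at_right 0. 0 < a * (cos t - 1) + b * sin (s * t)"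
      using d by (intro eventually_at_rightI[of 0 d]) auto
    with le[OF s] have "\<forall>\<^sub>F t in at_right (0::real). False" by eventually_elim simp
    then show False by simp
  qed
  \<comment> \<open>The first-order terms in both directions along the circle force the normal
    \<open>n\<close> to be radial.\<close>
  have b: "b = 0" using nonpos[of 1] nonpos[of "- 1"] N N' \<open>N = N'\<close> by simp
  have expand: "n \<bullet> y = a * (dir \<theta> \<bullet> y)" for y
    using inner_expand[of n y \<theta>] b by (simp add: a_def b_def inner_commute)
  then have "a \<noteq> 0" using n(1) by (metis inner_eq_zero_iff mult_zero_left)
  moreover have "0 \<le> a"
  proof -
    obtain t where t: "0 < t" "t < pi" "w + dir (\<theta> + 1 * t) \<in> N" by (rule arc_point[OF N(2) N(2) pi_gt_zero])
    then have "n \<bullet> (w + dir (\<theta> + t) - ?v) \<le> 0" using n(2) closure_subset by fastforce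
    then have "a * (cos t - 1) \<le> 0"
      using inner_dir_add[of n \<theta> t] b by (simp add: a_def b_def inner_diff_right algebra_simps)
    moreover have "cos t < 1" using cos_monotone_0_pi[of 0 t] t by simp
    ultimately show ?thesis by (simp add: mult_le_0_iff)
  qed
  ultimately have a: "0 < a" by simp
  have "X \<subseteq> {?v}"
  proof
    fix x assume x: "x \<in> X"
    then have "0 \<le> a * (dir \<theta> \<bullet> (x - ?v))" using n(3)[of x] closure_subset expand[of "x - ?v"] by force
    then have "1 \<le> dir \<theta> \<bullet> (x - w)" using a
      by (simp add: zero_le_mult_iff inner_diff_right inner_add_right inner_dir)
    moreover have "norm (x - w) \<le> 1" using x X(3) by (auto simp: dist_norm norm_minus_commute)
    then have "(norm (x - w))\<^sup>2 \<le> 1" by (simp add: power_le_one)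
    moreover have "(norm (x - w - dir \<theta>))\<^sup>2 = (norm (x - w))\<^sup>2 - 2 * (dir \<theta> \<bullet> (x - w)) + 1"
      by (simp add: power2_norm_eq_inner inner_diff_left inner_diff_right inner_dir inner_commute algebra_simps)
    ultimately have "(norm (x - w - dir \<theta>))\<^sup>2 \<le> 0" by simp
    then show "x \<in> {?v}" by (simp add: algebra_simps)
  qed
  then have "X = {?v}" using region_nonempty[OF X(1)] by blast
  then show False using region_open[OF X(1)] not_open_singleton by metis
qed

text \<open>Without a switch, the angles whose arcs lie in a given triangle form an open set, and
  these sets partition the real line. By connectedness one triangle has opposite points of the
  circle in its closure, which \<open>same_color_distances\<close> rules out.\<close>

lemma switch_exists:
  obtains \<theta> P P' where "P \<in> R" "P' \<in> R" "arc 1 v \<theta> P" "arc (- 1) v \<theta> P'" "P \<noteq> P'"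
proof (rule ccontr)
  assume none: "\<not> thesis"
  have same: "P = P'" if "P \<in> R" "P' \<in> R" "arc 1 v \<theta> P" "arc (- 1) v \<theta> P'" for \<theta> P P'
    using that none \<open>\<And>P P' \<theta>. \<lbrakk>P \<in> R; P' \<in> R; arc 1 v \<theta> P; arc (- 1) v \<theta> P'; P \<noteq> P'\<rbrakk> \<Longrightarrow> thesis\<close> by metis
  define E where "E P = {\<theta>. arc 1 v \<theta> P}" for P
  have "open (E P)" if "P \<in> R" for P
    unfolding open_dist
  proof
    fix \<theta> assume "\<theta> \<in> E P"
    then have P: "arc 1 v \<theta> P" by (simp add: E_def)
    obtain P' where P': "P' \<in> R" "arc (- 1) v \<theta> P'" by (rule arc_exists[of "- 1"]) auto
    then have "arc (- 1) v \<theta> P" using same[OF \<open>P \<in> R\<close> P'(1) P] by simp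
    with P have "\<forall>\<^sub>F t in at_right 0. v + dir (\<theta> + 1 * t) \<in> P \<and> v + dir (\<theta> + - 1 * t) \<in> P"
      unfolding arc_def by (rule eventually_conj)
    then obtain e where e: "0 < e" "\<And>t. \<lbrakk>0 < t; t < e\<rbrakk> \<Longrightarrow> v + dir (\<theta> + t) \<in> P \<and> v + dir (\<theta> - t) \<in> P"
      unfolding eventually_at_right_field by auto
    have "\<theta>' \<in> E P" if "dist \<theta>' \<theta> < e" for \<theta>'
    proof (cases "\<theta>' = \<theta>")
      case False
      then have "v + dir \<theta>' \<in> P"
        using e(2)[of "\<bar>\<theta>' - \<theta>\<bar>"] that by (auto simp: dist_real_def abs_if split: if_splits)
      then have "\<forall>\<^sub>F t in at_right 0. v + dir (\<theta>' + 1 * t) \<in> P"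
        by (intro topological_tendstoD[where l = "v + dir (\<theta>' + 1 * 0)"] tendsto_intros)
          (use region_open[OF \<open>P \<in> R\<close>] in auto)
      then show ?thesis by (simp add: E_def arc_def)
    qed (use P in \<open>simp add: E_def\<close>)
    then show "\<exists>e>0. \<forall>\<theta>'. dist \<theta>' \<theta> < e \<longrightarrow> \<theta>' \<in> E P" using e(1) by blast
  qed
  note opn = this
  obtain P where P: "P \<in> R" "arc 1 v 0 P" by (rule arc_exists[of 1]) auto
  have "- E P = (\<Union>Q\<in>R - {P}. E Q)"
  proof (intro equalityI subsetI)
    fix \<theta> assume "\<theta> \<in> - E P"
    moreover obtain Q where "Q \<in> R" "arc 1 v \<theta> Q" by (rule arc_exists[of 1]) auto
    ultimately show "\<theta> \<in> (\<Union>Q\<in>R - {P}. E Q)" by (auto simp: E_def)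
  next
    fix \<theta> assume "\<theta> \<in> (\<Union>Q\<in>R - {P}. E Q)"
    then show "\<theta> \<in> - E P" using arc_unique[of 1 v \<theta> P] P(1) by (auto simp: E_def)
  qed
  then have "open (- E P)" using opn by auto
  then have "E P = {} \<or> E P = UNIV" using clopen[of "E P"] opn[OF P(1)] by (simp add: closed_def)
  then have "arc 1 v \<theta> P" for \<theta> using P(2) by (auto simp: E_def)
  then have "v + dir 0 \<in> closure P" "v + dir pi \<in> closure P" using arc_limit by blast+
  moreover have "1 < dist (v + dir 0) (v + dir pi)" by (rule dist_dir_greater) simp_all
  moreover have "\<not> 1 \<le> dist (v + dir 0) (v + dir 0)" by simp
  ultimately show False using same_color_distances[OF P(1) P(1) refl] by (meson not_less)
qed

text \<open>On the circle around each \<open>v + dir (\<phi> j)\<close> the point \<open>v\<close>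
  is again a switch. The clockwise arc there starts in a triangle \<open>S j\<close> at
  \<open>v\<close>, confined to the unit disk around \<open>v + dir (\<phi> j + pi / 3)\<close>.
  Five consecutive ones are different, against \<open>degree_le_four\<close>.\<close>

theorem degree_le_three: "card (regions_at v) \<le> 3"
proof (rule ccontr)
  assume "\<not> ?thesis"
  then have four: "4 \<le> card (regions_at v)" by simp
  obtain \<theta> P P' where P: "P \<in> R" "arc 1 v \<theta> P" and P': "P' \<in> R" "arc (- 1) v \<theta> P'" and "P \<noteq> P'"
    by (rule switch_exists[of v])
  define \<phi> where "\<phi> j = \<theta> + real j * (pi / 3)" for j
  have switch: "\<exists>Q\<in>R. \<exists>Q'\<in>R. arc 1 v (\<phi> j) Q \<and> arc (- 1) v (\<phi> j) Q' \<and> Q \<noteq> Q'" for j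
  proof (induction j)
    case 0
    then show ?case using P P' \<open>P \<noteq> P'\<close> unfolding \<phi>_def by auto
  next
    case (Suc j)
    then obtain Q Q' where Q: "Q \<in> R" "arc 1 v (\<phi> j) Q" "Q' \<in> R" "arc (- 1) v (\<phi> j) Q'" "Q \<noteq> Q'" by blast
    have "\<phi> (Suc j) = \<phi> j + 1 * pi / 3" by (simp add: \<phi>_def algebra_simps)
    then show ?case using switch_step(3)[OF four _ Q] by simp
  qed
  have "\<exists>S\<in>R. arc (- 1) (v + dir (\<phi> j)) (\<phi> j + pi) S \<and> S \<subseteq> ball (v + dir (\<phi> j + pi / 3)) 1" for j
  proof -
    let ?w = "v + dir (\<phi> j)"
    obtain Q Q' where Q: "Q \<in> R" "arc 1 v (\<phi> j) Q" "Q' \<in> R" "arc (- 1) v (\<phi> j) Q'" "Q \<noteq> Q'"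
      using switch by blast
    have four': "4 \<le> card (regions_at ?w)" by (rule switch_degree(1)[OF four Q])
    obtain X where X: "X \<in> R" "v \<in> closure X" "X \<subseteq> cball ?w 1" using switch_degree(2)[OF four Q] by blast
    obtain N where N: "N \<in> R" "arc 1 ?w (\<phi> j + pi) N" by (rule arc_exists[of 1]) auto
    obtain N' where N': "N' \<in> R" "arc (- 1) ?w (\<phi> j + pi) N'" by (rule arc_exists[of "- 1"]) auto
    have "N \<noteq> N'" by (rule arcs_distinct[OF X(1) _ X(3) N N']) (use X(2) in \<open>simp add: dir_pi\<close>)
    then have "N' \<subseteq> ball (?w + dir (\<phi> j + pi + (- 1) * pi / 3)) 1"
      using N(2) by (intro switch_step(1)[OF four' _ N' N(1)]) auto
    moreover have "?w + dir (\<phi> j + pi + (- 1) * pi / 3) = v + dir (\<phi> j + pi / 3)"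
    proof -
      have "\<phi> j + pi + (- 1) * pi / 3 = \<phi> j + 2 * pi / 3" by simp
      moreover have "\<phi> j + 2 * pi / 3 - pi / 3 = \<phi> j + pi / 3" by simp
      ultimately show ?thesis using dir_third[of "\<phi> j + 2 * pi / 3"] by (simp add: ac_simps)
    qed
    ultimately have "N' \<subseteq> ball (v + dir (\<phi> j + pi / 3)) 1" by (simp only:)
    then show ?thesis using N' by blast
  qed
  then obtain S where S: "\<And>j. S j \<in> R" "\<And>j. arc (- 1) (v + dir (\<phi> j)) (\<phi> j + pi) (S j)"
    "\<And>j. S j \<subseteq> ball (v + dir (\<phi> j + pi / 3)) 1" by metis
  have ne: "S i \<noteq> S j" if ij: "i < j" "j \<le> i + 4" for i j
  proof
    assume eq: "S i = S j"
    have "0 < pi / 3" by simp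
    then obtain t where t: "0 < t" "t < pi / 3" "v + dir (\<phi> j) + dir (\<phi> j + pi + (- 1) * t) \<in> S j"
      by (rule arc_point[OF S(2) S(2)])
    \<comment> \<open>\<open>v + p\<close> is a point of \<open>S j\<close> on the circle around
      \<open>v + dir (\<phi> j)\<close>, and \<open>a\<close> is the angle from the direction of the
      centre of the disk of \<open>S i\<close> to that of \<open>dir (\<phi> j)\<close>.\<close>
    define a where "a = \<phi> j - (\<phi> i + pi / 3)"
    define p where "p = dir (\<phi> j) - dir (\<phi> j - t)"
    have "dir (\<phi> j + pi + (- 1) * t) = - dir (\<phi> j - t)"
      using dir_pi[of "\<phi> j - t"] by (simp add: algebra_simps)
    then have "v + p \<in> S j" using t(3) by (simp add: p_def add_diff_eq)
    then have "dist (v + p) (v + dir (\<phi> i + pi / 3)) < 1" using S(3)[of i] eq by (auto simp: dist_commute)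
    then have "norm (p - dir (\<phi> i + pi / 3)) < 1" by (simp add: dist_norm)
    then have "(norm (p - dir (\<phi> i + pi / 3)))\<^sup>2 < 1" by (simp add: power_less_one_iff)
    moreover have "(norm (p - dir (\<phi> i + pi / 3)))\<^sup>2 = (norm p)\<^sup>2 - 2 * (p \<bullet> dir (\<phi> i + pi / 3)) + 1"
      by (simp add: power2_norm_eq_inner inner_diff_left inner_diff_right inner_dir inner_commute algebra_simps)
    moreover have "(norm p)\<^sup>2 = 2 - 2 * cos t"
      using dist_dir[of 0 "\<phi> j" "\<phi> j - t"] by (simp add: dist_norm p_def)
    moreover have "p \<bullet> dir (\<phi> i + pi / 3) = cos a - cos (a - t)"
      by (simp add: p_def inner_diff_left inner_dir a_def algebra_simps)
    ultimately have *: "1 - cos t < cos a - cos (a - t)" by simp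
    \<comment> \<open>The inequality just derived becomes an equality for \<open>a = 0\<close>.
      Otherwise \<open>a\<close> is at least \<open>pi / 3\<close>, hence larger than
      \<open>t\<close>, and \<open>j \<le> i + 4\<close> bounds it by \<open>pi\<close>, where the
      cosine decreases.\<close>
    have a: "a = real (j - i - 1) * (pi / 3)" using ij by (simp add: a_def \<phi>_def of_nat_diff algebra_simps)
    show False
    proof (cases "j - i - 1 = 0")
      case True
      then show False using * a by simp
    next
      case False
      then have "1 * (pi / 3) \<le> a" "a \<le> 3 * (pi / 3)" unfolding a using ij by (intro mult_right_mono; simp)+
      then have "cos a \<le> cos (a - t)" using t by (intro cos_monotone_0_pi_le) auto
      moreover have "cos t \<le> 1" by simp
      ultimately show False using * by simp
    qed
  qed
  have "inj_on S {..4}"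
  proof (rule linorder_inj_onI)
    fix i j :: nat assume "i < j" "i \<in> {..4}" "j \<in> {..4}"
    then show "S i \<noteq> S j" by (intro ne) auto
  qed auto
  then have "card (S ` {..4}) = 5" by (simp add: card_image)
  moreover have "S ` {..4} \<subseteq> regions_at v"
  proof -
    have "v + dir (\<phi> j) + dir (\<phi> j + pi) \<in> closure (S j)" for j using arc_limit[OF S(2)] .
    then show ?thesis using S(1) by (auto simp: regions_at_iff dir_pi)
  qed
  ultimately have "5 \<le> card (regions_at v)" using card_mono[OF finite_regions_at] by metis
  moreover have "card (regions_at v) \<le> 4"
    using touching[OF P(1) P'(1) \<open>P \<noteq> P'\<close> arc_limit[OF P(2)] arc_limit[OF P'(2)]]
    by (rule degree_le_four[OF P(1) P'(1) _ arc_color[OF P] arc_color[OF P']])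
  ultimately show False by simp
qed

end

section \<open>Triangle colorings\<close>

text \<open>Only finitely many borders and vertices occur near \<open>x\<close>, each inside a
  segment, and a finite union of closed sets with empty interior cannot fill a disk.\<close>

lemma (in triangle_coloring) regions_dense: "ball x \<epsilon> \<inter> \<Union>regions \<noteq> {}" if "0 < \<epsilon>"
proof
  assume none: "ball x \<epsilon> \<inter> \<Union>regions = {}"
  define \<F> where "\<F> = {A \<in> regions \<union> borders \<union> (\<lambda>v. {v}) ` vertices. A \<inter> cball x \<epsilon> \<noteq> {}} - regions"
  have fin: "finite \<F>" unfolding \<F>_def using locally_finite by (rule finite_Diff)
  have seg: "\<exists>p q. A \<subseteq> closed_segment p q" if A: "A \<in> \<F>" for A
  proof (cases "A \<in> borders")
    case True
    then obtain p q where "A = open_segment p q" using border by blast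
    then show ?thesis using segment_open_subset_closed by blast
  next
    case False
    then obtain v where "A = {v}" using A by (auto simp: \<F>_def)
    then have "A \<subseteq> closed_segment v v" by simp
    then show ?thesis by blast
  qed
  have "interior (\<Union>(closure ` \<F>)) = {}" if "finite \<F>" "\<And>A. A \<in> \<F> \<Longrightarrow> \<exists>p q. A \<subseteq> closed_segment p q"
    for \<F> :: "(real ^ 2) set set"
    using that
  proof (induction \<F> rule: finite_induct)
    case (insert A \<F>)
    obtain p q where "A \<subseteq> closed_segment p q" using insert.prems by blast
    then have "closure A \<subseteq> closed_segment p q" by (intro closure_minimal) auto
    then have "interior (closure A) \<subseteq> interior (closed_segment p q)" by (rule interior_mono)
    then have A: "interior (closure A) = {}" by (simp add: interior_closed_segment_ge2)
    have "interior (\<Union>(closure ` \<F>) \<union> closure A) = interior (\<Union>(closure ` \<F>))"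
      using insert.hyps A by (intro interior_closed_Un_empty_interior closed_UN) auto
    then show ?case using insert by (simp add: Un_commute)
  qed simp
  then have "interior (\<Union>(closure ` \<F>)) = {}" using fin seg by blast
  moreover have "ball x \<epsilon> \<subseteq> \<Union>(closure ` \<F>)"
  proof
    fix y assume y: "y \<in> ball x \<epsilon>"
    obtain A where A: "A \<in> regions \<union> borders \<union> (\<lambda>v. {v}) ` vertices" "y \<in> A"
      using partition_onD1[OF partition] by blast
    then have "A \<notin> regions" using none y by blast
    moreover have "y \<in> cball x \<epsilon>" using y by simp
    ultimately have "A \<in> \<F>" using A by (auto simp: \<F>_def)
    then show "y \<in> \<Union>(closure ` \<F>)" using A(2) closure_subset by blast
  qed
  ultimately have "ball x \<epsilon> \<subseteq> {}" by (metis interior_maximal open_ball)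
  then show False using that by simp
qed

lemma (in triangle_coloring) triangle_tiling_regions: "triangle_tiling regions"
proof
  have fin: "finite {P \<in> regions. closure P \<inter> cball x r \<noteq> {}}" for x r
  \<comment> \<open>A triangle whose closure meets the disk of radius \<open>r\<close> itself meets
    the disk of radius \<open>r + 1\<close>.\<close>
  proof (rule finite_subset[OF _ locally_finite[of x "r + 1"]], rule subsetI)
    fix P assume "P \<in> {P \<in> regions. closure P \<inter> cball x r \<noteq> {}}"
    then obtain y where P: "P \<in> regions" "y \<in> closure P" "dist x y \<le> r" by auto
    obtain z where z: "z \<in> P" "dist z y < 1" using P(2) closure_approachable[of y P] by (metis zero_less_one)
    have "dist x z \<le> dist x y + dist z y" by (metis dist_commute dist_triangle)
    then have "z \<in> cball x (r + 1)" using z P by simp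
    then show "P \<in> {A \<in> regions \<union> borders \<union> (\<lambda>v. {v}) ` vertices. A \<inter> cball x (r + 1) \<noteq> {}}"
      using P(1) z(1) by blast
  qed
  then show "finite {P \<in> regions. closure P \<inter> cball x r \<noteq> {}}" for x r .
  show "open_triangle P" if "P \<in> regions" for P using region_triangle that .
  show "P = Q" if "P \<in> regions" "Q \<in> regions" "P \<inter> Q \<noteq> {}" for P Q
    using partition_onD2[OF partition] that by (auto simp: disjoint_def)
  show "\<exists>P\<in>regions. x \<in> closure P" for x
  proof -
    let ?F = "{P \<in> regions. closure P \<inter> cball x 1 \<noteq> {}}"
    have "x \<in> closure (\<Union>?F)"
      unfolding closure_approachable
    proof (intro allI impI)
      fix e :: real assume "0 < e"
      then have "ball x (min e 1) \<inter> \<Union>regions \<noteq> {}" by (intro regions_dense) simp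
      then obtain y P where y: "y \<in> ball x (min e 1)" "P \<in> regions" "y \<in> P" by blast
      then have "P \<in> ?F" using closure_subset by fastforce
      moreover have "dist y x < e" using y(1) by (simp add: dist_commute)
      ultimately show "\<exists>y\<in>\<Union>?F. dist y x < e" using y(3) by blast
    qed
    \<comment> \<open>Local finiteness is what makes the union of the closures closed.\<close>
    moreover have "closure (\<Union>?F) \<subseteq> \<Union>(closure ` ?F)"
    proof (rule closure_minimal)
      show "\<Union>?F \<subseteq> \<Union>(closure ` ?F)" using closure_subset by blast
      show "closed (\<Union>(closure ` ?F))" using fin by (intro closed_UN) auto
    qed
    ultimately show ?thesis by blast
  qed
qed

text \<open>A common point of the closures lies on both frontiers. If it is not a vertex, it is on a
  border of each region, and these borders coincide because borders are disjoint.\<close>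

lemma (in triangle_coloring) touching_regions:
  assumes P: "P \<in> regions" "Q \<in> regions" "P \<noteq> Q" and v: "v \<in> closure P" "v \<in> closure Q"
    and xy: "x \<in> P" "y \<in> Q"
  shows "col x \<noteq> col y"
proof -
  interpret triangle_tiling regions by (rule triangle_tiling_regions)
  have "v \<notin> P" "v \<notin> Q" using region_closure_eq P v by blast+
  then have fr: "v \<in> frontier P" "v \<in> frontier Q"
    using v P region_open by (auto simp: frontier_def interior_open)
  show ?thesis
  proof (cases "v \<in> vertices")
    case True
    then show ?thesis using vertex_colors[OF P] fr xy by blast
  next
    case False
    obtain b where b: "b \<in> borders" "v \<in> b" "b \<subseteq> frontier P"
      using region_enclosed[OF P(1)] fr False by blast
    obtain b' where b': "b' \<in> borders" "v \<in> b'" "b' \<subseteq> frontier Q"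
      using region_enclosed[OF P(2)] fr False by blast
    have "b = b'" using partition_onD2[OF partition] b b' by (auto simp: disjoint_def)
    then show ?thesis using border_colors[OF P b(1,3)] b' xy by blast
  qed
qed

theorem theorem2:
  fixes col :: "real ^ 2 \<Rightarrow> 'c"
    and regions borders :: "(real ^ 2) set set"
    and vertices :: "(real ^ 2) set"
  assumes "triangle_coloring col regions borders vertices"
  shows "7 \<le> card (range col)"
proof (rule ccontr)
  assume "\<not> ?thesis"
  then have few: "card (range col) \<le> 6" by simp
  interpret C: triangle_coloring col regions borders vertices by (rule assms)
  interpret T: triangle_tiling regions by (rule C.triangle_tiling_regions)
  define color where "color P = col (SOME x. x \<in> P)" for P
  have color: "color P = col x" if "P \<in> regions" "x \<in> P" for P x
  proof -
    have "(SOME x. x \<in> P) \<in> P" using that(2) by (rule someI)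
    then show ?thesis
      using C.region_uniform[OF that(1)] that(2) unfolding color_def constant_on_def by metis
  qed
  have sub: "color ` regions \<subseteq> range col" by (auto simp: color_def)
  interpret colored_tiling regions color
  proof
    show "color P \<noteq> color Q"
      if "P \<in> regions" "Q \<in> regions" "P \<noteq> Q" "x \<in> closure P" "x \<in> closure Q" for P Q x
    proof -
      obtain p q where "p \<in> P" "q \<in> Q" using T.region_nonempty \<open>P \<in> regions\<close> \<open>Q \<in> regions\<close> by blast
      then show ?thesis using C.touching_regions[OF that] color that by metis
    qed
    show "color P \<noteq> color Q"
      if "P \<in> regions" "Q \<in> regions" "x \<in> P" "y \<in> Q" "dist x y = 1" for P Q x y
      using C.unit_distance[OF that(5)] color that by metis
    show "finite (color ` regions)" using finite_subset[OF sub C.finite_colors] .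
    show "card (color ` regions) \<le> 6" using card_mono[OF C.finite_colors sub] few by simp
  qed
  interpret small_degree_tiling regions by unfold_locales (rule degree_le_three)
  show False by (rule no_small_degree_tiling)
qed

end
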